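(* Let $s,t$ be integers. If $t\equiv\pm1\pmod s$ and $(t^2-1)st\neq0$, then $\tfrac st\in\mathcal{CS}$.
   Context: For $q\in\mathbb Q$ let $\Gamma_q\le \mathrm{SL}(2,\mathbb R)$ be the subgroup generated by $\begin{pmatrix}1&1\\0&1\end{pmatrix}$ and $\begin{pmatrix}1&0\\ q&1\end{pmatrix}$. For coprime integers $s,t$ with $t\neq0$, $\Gamma_1^{(t)}(s)$ is the group of matrices $\begin{pmatrix}a&b\\c&d\end{pmatrix}\in \mathrm{SL}(2,\mathbb Z[\tfrac1t])$ with $a-1,\ d-1,\ c\in s\mathbb Z[\tfrac1t]$. The set $\mathcal{CS}$ is the set of all $q\in\mathbb Q\cap(-4,4)$ such that, writing $q=\tfrac st$ in lowest terms, $\Gamma_q=\Gamma_1^{(t)}(s)$. *)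

theory Defs
  imports
    "HOL-Analysis.Analysis"
    "HOL-Algebra.Generated_Groups"
    "HOL-Number_Theory.Cong"
begin

definition mat2 :: "real \<Rightarrow> real \<Rightarrow> real \<Rightarrow> real \<Rightarrow> real^2^2" where
  "mat2 a b c d = vector [vector [a, b], vector [c, d]]"

definition SL2R :: "(real^2^2) monoid" where
  "SL2R = \<lparr>carrier = {A. det A = 1}, mult = (**), one = mat 1\<rparr>"

lemma group_SL2R: "group SL2R"
proof (rule groupI)
  fix A assume "A \<in> carrier SL2R"
  then have A: "det A = 1" by (simp add: SL2R_def)
  then obtain B where B: "B ** A = mat 1"
    by (metis invertible_det_nz invertible_def zero_neq_one)
  moreover from this have "det B = 1"
    using A by (metis det_I det_mul mult.right_neutral)
  ultimately show "\<exists>B\<in>carrier SL2R. B \<otimes>\<^bsub>SL2R\<^esub> A = \<one>\<^bsub>SL2R\<^esub>"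
    by (auto simp: SL2R_def)
qed (auto simp: SL2R_def det_mul matrix_mul_assoc)

definition Gamma_gen :: "rat \<Rightarrow> (real^2^2) set" where
  "Gamma_gen q = generate SL2R {mat2 1 1 0 1, mat2 1 0 (of_rat q) 1}"

text \<open>The ring \<open>\<int>[1/t]\<close> as a subset of the reals; only meaningful for \<open>t \<noteq> 0\<close>.\<close>

definition Z_inv :: "int \<Rightarrow> real set" where
  "Z_inv t = {of_int a / of_int t ^ n | (a::int) (n::nat). True}"

definition SL2_Z_inv :: "int \<Rightarrow> (real^2^2) set" where
  "SL2_Z_inv t = {A \<in> carrier SL2R. \<forall>i j. A $ i $ j \<in> Z_inv t}"

text \<open>\<open>Gamma_gen q\<close> is \<open>\<Gamma>\<^sub>q\<close>, and \<open>Gamma_one t s\<close> (for coprime \<open>s\<close>, \<open>t\<close> with \<open>t \<noteq> 0\<close>) is \<open>\<Gamma>\<^sub>1\<^bsup>(t)\<^esup>(s)\<close>.\<close>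

definition Gamma_one :: "int \<Rightarrow> int \<Rightarrow> (real^2^2) set" where
  "Gamma_one t s = {A \<in> SL2_Z_inv t.
     A $ 1 $ 1 - 1 \<in> (*) (of_int s) ` Z_inv t \<and>
     A $ 2 $ 2 - 1 \<in> (*) (of_int s) ` Z_inv t \<and>
     A $ 2 $ 1 \<in> (*) (of_int s) ` Z_inv t}"

lemma Z_inv_uminus: "Z_inv (- t) = Z_inv t"
proof -
  have sub: "Z_inv (- t) \<subseteq> Z_inv t" for t
  proof
    fix x assume "x \<in> Z_inv (- t)"
    then obtain a n where "x = of_int a / of_int (- t) ^ n" by (auto simp: Z_inv_def)
    then have "x = of_int ((- 1) ^ n * a) / of_int t ^ n"
      by (cases "even n") auto
    then show "x \<in> Z_inv t" unfolding Z_inv_def by blast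
  qed
  from sub[of t] sub[of "- t"] show ?thesis by auto
qed

lemma uminus_mult_image_Z_inv:
  "(*) (of_int (- s)) ` Z_inv t = (*) (of_int s) ` Z_inv t"
proof -
  have neg: "- x \<in> Z_inv t" if "x \<in> Z_inv t" for x
  proof -
    from that obtain a n where "x = of_int a / of_int t ^ n" by (auto simp: Z_inv_def)
    then have "- x = of_int (- a) / of_int t ^ n" by simp
    then show ?thesis unfolding Z_inv_def by blast
  qed
  have "(*) (of_int (- s)) ` Z_inv t \<subseteq> (*) (of_int s) ` Z_inv t" for s
  proof
    fix x assume "x \<in> (*) (of_int (- s)) ` Z_inv t"
    then obtain y where "y \<in> Z_inv t" "x = of_int s * (- y)" by auto
    then show "x \<in> (*) (of_int s) ` Z_inv t" using neg by blast
  qed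
  from this[of s] this[of "- s"] show ?thesis by auto
qed

lemma Gamma_one_uminus: "Gamma_one (- t) (- s) = Gamma_one t s"
  unfolding Gamma_one_def SL2_Z_inv_def Z_inv_uminus uminus_mult_image_Z_inv ..

text \<open>
  \<^const>\<open>quotient_of\<close> returns the representation in lowest terms with positive denominator.
  By \<open>Gamma_one_uminus\<close> the choice of sign is immaterial.
\<close>

definition CS :: "rat set" where
  "CS = {q. - 4 < q \<and> q < 4 \<and> (case quotient_of q of (s, t) \<Rightarrow> Gamma_gen q = Gamma_one t s)}"

lemma CS_iff:
  assumes "coprime s t" "t \<noteq> 0" "q = of_int s / of_int t"
  shows "q \<in> CS \<longleftrightarrow> - 4 < q \<and> q < 4 \<and> Gamma_gen q = Gamma_one t s"
proof (cases "t > 0")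
  case True
  then have "quotient_of q = (s, t)"
    using assms by (simp add: quotient_of_Fract Fract_of_int_quotient[symmetric] normalize_stable)
  then show ?thesis by (simp add: CS_def)
next
  case False
  then have "quotient_of (of_int (- s) / of_int (- t)) = (- s, - t)"
    using assms unfolding Fract_of_int_quotient[symmetric]
    by (simp add: quotient_of_Fract normalize_stable del: minus_rat)
  then have "quotient_of q = (- s, - t)" using assms by simp
  then show ?thesis by (simp add: CS_def Gamma_one_uminus)
qed

end

theory Submission
  imports Defs "HOL-Number_Theory.Number_Theory" "HOL-Computational_Algebra.Squarefree"
begin

text \<open>
  Write \<open>t = e + s m\<close> with \<open>e = 1\<close> or \<open>e = -1\<close>, let \<open>R = \<int>[1/t]\<close> and \<open>u = e t\<close>. The congruence on
  \<open>t\<close> says that \<open>u\<close> is a unit of \<open>R\<close> with \<open>u \<equiv> 1\<close> modulo \<open>s\<close>, and it has infinite order.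

  This makes the generated group \<open>H\<close> large: a product of three explicit unipotent elements of \<open>H\<close> is
  lower triangular with diagonal \<open>(1/u, u)\<close>. Conjugating by it shrinks unipotent matrices by powers
  of \<open>u\<close>, so \<open>H\<close> contains all upper unipotent matrices over \<open>R\<close>, all lower unipotent
  matrices with entry in \<open>s R\<close>, and the diagonal matrix \<open>D = (u, 1/u)\<close>. A matrix of the congruence group is
  determined by its first column \<open>(a, s c)\<close> up to an upper unipotent factor, so everything comes down to
  showing that each such column is the first column of an element of \<open>H\<close>. The column may be
  altered by adding multiples of \<open>s c\<close> to \<open>a\<close>, by adding multiples of \<open>a\<close> to \<open>c\<close>, and by the scaling
  \<open>(u a, c/u)\<close>; it is harmless as soon as \<open>c\<close> is a unit of \<open>R\<close>. A general column is first brought to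
  coprime integers \<open>a, c\<close> with \<open>a \<equiv> 1\<close> modulo \<open>s\<close>.

  The heart of the proof is the reduction of coprime integers, \<open>reducible_coprime\<close>. By Dirichlet's theorem
  \<open>c\<close> may be replaced by a large prime \<open>q \<equiv> c\<close> modulo \<open>a\<close>. Let \<open>L\<close> be the totient of
  \<open>\<bar>a\<bar>\<close>, so that \<open>q\<close> may in turn be replaced by \<open>q ^ n\<close> whenever \<open>n \<equiv> 1\<close> modulo \<open>L\<close>. The
  \<open>q\<close>-adic closure of the powers of \<open>u\<close> contains \<open>1 + q\<^sup>k \<int>\<^sub>q\<close> for some \<open>k\<close>; hence \<open>a\<close> may be replaced by any
  \<open>v\<close> with \<open>v \<equiv> a\<close> modulo \<open>q ^ k\<close> and \<open>v \<equiv> 1\<close> modulo \<open>s\<close>, up to a power of \<open>u\<close>, which the scaling moves to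
  the other entry. Choose \<open>v = -p\<close> with \<open>p\<close> prime and, in addition, \<open>v \<equiv> 1\<close> modulo \<open>4 s L\<close>. Then
  \<open>h = (p - 1)/2\<close> satisfies \<open>h \<equiv> -1\<close> modulo \<open>L\<close>, so \<open>n = h\<^sup>2\<close> is an admissible exponent, and
  \<open>q ^ n\<close> is \<open>1\<close> or \<open>-1\<close> modulo \<open>p\<close> because \<open>n\<close> is a multiple of \<open>h\<close>. Thus the second entry becomes a power of
  \<open>u\<close> up to sign, a unit. The negative sign of \<open>v\<close> is essential: it is what makes \<open>h\<close> coprime
  to \<open>L\<close>.

  Dirichlet's theorem is proved with characters and elementary estimates. For a character \<open>f\<close> other than the
  principal one, the sum of \<open>f(d) \<Lambda>(d) / d\<close> over \<open>d \<le> x\<close> is bounded if the series \<open>L(1, f)\<close> of \<open>f(n) / n\<close> does not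
  vanish, and is \<open>- ln x + O(1)\<close> if it does. Summing over all characters, where the principal one
  contributes at most \<open>ln x + O(1)\<close> and the total is nonnegative, shows that at most one series vanishes. Since
  complex conjugation preserves vanishing, the character would be real, and for real characters a
  comparison of the Lambert series of \<open>f\<close> with \<open>L(1, f) / (1 - t)\<close> as \<open>t\<close> tends to 1 excludes this.
\<close>

section \<open>Dirichlet characters\<close>

definition dchars :: "nat \<Rightarrow> (nat \<Rightarrow> complex) set" where
  "dchars N = {f. f 1 = 1 \<and> (\<forall>m n. f (m * n) = f m * f n) \<and> (\<forall>n. f (n mod N) = f n) \<and>
     (\<forall>n. f n = 0 \<longleftrightarrow> \<not> coprime n N)}"

text \<open>A character modulo \<open>N\<close> that is defined only on a subgroup of the unit group. The subgroup is represented
  by the union \<open>K\<close> of its residue classes, so that no quotient is needed.\<close>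

definition pchar :: "nat \<Rightarrow> nat set \<Rightarrow> (nat \<Rightarrow> complex) \<Rightarrow> bool" where
  "pchar N K f \<longleftrightarrow> 1 \<in> K \<and> f 1 = 1 \<and> (\<forall>x\<in>K. coprime x N) \<and>
     (\<forall>x\<in>K. \<forall>y\<in>K. x * y \<in> K \<and> f (x * y) = f x * f y) \<and>
     (\<forall>x\<in>K. \<forall>y. [y = x] (mod N) \<longrightarrow> y \<in> K \<and> f y = f x)"

lemma pchar_one: "pchar N K f \<Longrightarrow> 1 \<in> K" "pchar N K f \<Longrightarrow> f 1 = 1"
  and pchar_coprime: "pchar N K f \<Longrightarrow> x \<in> K \<Longrightarrow> coprime x N"
  and pchar_mult: "pchar N K f \<Longrightarrow> x \<in> K \<Longrightarrow> y \<in> K \<Longrightarrow> x * y \<in> K"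
                  "pchar N K f \<Longrightarrow> x \<in> K \<Longrightarrow> y \<in> K \<Longrightarrow> f (x * y) = f x * f y"
  and pchar_cong: "pchar N K f \<Longrightarrow> x \<in> K \<Longrightarrow> [y = x] (mod N) \<Longrightarrow> y \<in> K"
                  "pchar N K f \<Longrightarrow> x \<in> K \<Longrightarrow> [y = x] (mod N) \<Longrightarrow> f y = f x"
  unfolding pchar_def by blast+

lemma pchar_power:
  assumes "pchar N K f" "x \<in> K"
  shows "x ^ n \<in> K \<and> f (x ^ n) = f x ^ n"
  using assms by (induction n) (simp_all add: pchar_one[simplified] pchar_mult)

lemma pchar_nonzero:
  assumes "pchar N K f" "x \<in> K" "N > 0"
  shows "f x \<noteq> 0"
proof
  assume "f x = 0"
  have "[x ^ totient N = 1] (mod N)" using euler_theorem[OF pchar_coprime[OF assms(1,2)]] .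
  then have "f x ^ totient N = 1"
    using pchar_cong(2)[OF assms(1) pchar_one(1)[OF assms(1)]] pchar_power[OF assms(1,2)] pchar_one(2)[OF assms(1)]
    by metis
  then show False using \<open>f x = 0\<close> assms(3) by (simp add: power_0_left)
qed

text \<open>Closure under inverses comes for free: by Euler's theorem \<open>x\<close> to the power \<open>totient N - 1\<close> is an
  inverse of \<open>x\<close>.\<close>

lemma pchar_cancel:
  assumes "pchar N K f" "N > 0" "x \<in> K" "x * y \<in> K"
  shows "y \<in> K"
proof -
  have "totient N = Suc (totient N - 1)" using assms(2) by (simp add: Suc_diff_1)
  then have "x ^ totient N = x ^ (totient N - 1) * x" by (metis power_Suc2)
  then have eq: "x ^ (totient N - 1) * (x * y) = x ^ totient N * y" by simp
  have "[x ^ totient N * y = 1 * y] (mod N)"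
    using euler_theorem[OF pchar_coprime[OF assms(1,3)]] by (rule cong_scalar_right)
  then have "[y = x ^ (totient N - 1) * (x * y)] (mod N)" unfolding eq by (simp add: cong_sym)
  then show ?thesis
    using pchar_cong(1)[OF assms(1)] pchar_mult(1)[OF assms(1)] pchar_power[OF assms(1,3)] assms(4) by blast
qed

text \<open>The step by which characters of the whole unit group are built up, one element \<open>h\<close> at a time. The choice among
  the \<open>e\<close>-th roots is left open, so that a nontrivial value at a given element can be enforced.\<close>

lemma pchar_extend:
  assumes p: "pchar N K f" and N: "N > 0" and h: "coprime h N"
    and e: "e > 0" "h ^ e \<in> K" "\<And>i. 0 < i \<Longrightarrow> i < e \<Longrightarrow> h ^ i \<notin> K" and z: "z ^ e = f (h ^ e)"
  shows "\<exists>K' f'. pchar N K' f' \<and> K \<subseteq> K' \<and> (\<forall>x\<in>K. f' x = f x) \<and> h \<in> K' \<and> f' h = z"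
proof -
  define P where "P x k i \<longleftrightarrow> k \<in> K \<and> [x = k * h ^ i] (mod N)" for x k i
  define K' where "K' = {x. \<exists>k i. P x k i}"
  define f' where "f' x = (SOME w. \<exists>k i. P x k i \<and> w = f k * z ^ i)" for x
  \<comment> \<open>Independence of the representation: two representations of one class differ by a power
    \<open>h ^ g\<close> that lies in \<open>K\<close>, and minimality of \<open>e\<close> forces \<open>e\<close> to divide \<open>g\<close>.\<close>
  have le: "f k * z ^ i = f k' * z ^ j" if "P x k i" "P y k' j" "[x = y] (mod N)" "i \<le> j" for x y k k' i j
  proof -
    define g where "g = j - i"
    have j: "j = g + i" using that(4) by (simp add: g_def)
    have "[k * h ^ i = k' * h ^ j] (mod N)"
      using that unfolding P_def by (meson cong_sym cong_trans)
    then have "[k * h ^ i = (k' * h ^ g) * h ^ i] (mod N)" by (simp add: j power_add mult.assoc)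
    moreover have "coprime (h ^ i) N" using h by simp
    ultimately have kg: "[k' * h ^ g = k] (mod N)" by (metis cong_mult_rcancel_nat cong_sym)
    have kK: "k \<in> K" "k' \<in> K" using that by (auto simp: P_def)
    have "k' * h ^ g \<in> K" using pchar_cong(1)[OF p kK(1) kg] .
    then have gK: "h ^ g \<in> K" by (rule pchar_cancel[OF p N kK(2)])
    have eK: "(h ^ e) ^ l \<in> K" "f ((h ^ e) ^ l) = f (h ^ e) ^ l" for l using pchar_power[OF p e(2)] by auto
    have split: "h ^ g = (h ^ e) ^ (g div e) * h ^ (g mod e)"
      by (simp flip: power_mult power_add)
    then have "h ^ (g mod e) \<in> K" using pchar_cancel[OF p N eK(1), of "g div e"] gK by simp
    then have "g mod e = 0" using e(3)[of "g mod e"] e(1) by (cases "g mod e = 0") auto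
    then have "f (h ^ g) = (z ^ e) ^ (g div e)" using split eK(2)[of "g div e"] z by simp
    also have "\<dots> = z ^ g" using \<open>g mod e = 0\<close> by (metis mult_div_mod_eq add_0_right power_mult)
    finally have "f k = f k' * z ^ g"
      using pchar_cong(2)[OF p kK(1) kg] pchar_mult(2)[OF p kK(2) gK] by simp
    then show ?thesis by (simp add: j power_add)
  qed
  have wd: "f k * z ^ i = f k' * z ^ j" if "P x k i" "P y k' j" "[x = y] (mod N)" for x y k k' i j
    using le[OF that] le[OF that(2,1) cong_sym[OF that(3)]] by (cases "i \<le> j") auto
  have f': "f' x = f k * z ^ i" if "P x k i" for x k i
  proof -
    have "\<exists>k i. P x k i \<and> f' x = f k * z ^ i"
      unfolding f'_def by (rule someI_ex) (use that in blast)
    then show ?thesis using wd[OF _ that cong_refl] by metis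
  qed
  have PK: "P x x 0" if "x \<in> K" for x using that by (simp add: P_def)
  have Ph: "P h 1 1" using pchar_one[OF p] by (simp add: P_def)
  have Pm: "P (x * y) (k * k') (i + j)" if "P x k i" "P y k' j" for x y k k' i j
  proof -
    have "[x * y = (k * h ^ i) * (k' * h ^ j)] (mod N)" using that unfolding P_def by (intro cong_mult) auto
    then show ?thesis using that pchar_mult(1)[OF p] by (simp add: P_def power_add mult_ac)
  qed
  have Pc: "P y k i" if "P x k i" "[y = x] (mod N)" for x y k i
    using that unfolding P_def by (meson cong_trans)
  have Pcop: "coprime x N" if "P x k i" for x k i
  proof -
    have "coprime (k * h ^ i) N" using that h pchar_coprime[OF p] by (simp add: P_def)
    then show ?thesis using that unfolding P_def by (meson cong_imp_coprime cong_sym)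
  qed
  have "pchar N K' f'"
    unfolding pchar_def
  proof (intro conjI ballI allI impI)
    have "P 1 1 0" using PK pchar_one(1)[OF p] by blast
    then show "1 \<in> K'" "f' 1 = 1" using f'[of 1 1 0] pchar_one(2)[OF p] by (auto simp: K'_def)
    fix x assume "x \<in> K'"
    then obtain k i where x: "P x k i" by (auto simp: K'_def)
    show "coprime x N" using Pcop[OF x] .
    { fix y assume "y \<in> K'"
      then obtain k' j where y: "P y k' j" by (auto simp: K'_def)
      show "x * y \<in> K'" using Pm[OF x y] by (auto simp: K'_def)
      have "f (k * k') = f k * f k'" using x y pchar_mult(2)[OF p] by (auto simp: P_def)
      then show "f' (x * y) = f' x * f' y"
        unfolding f'[OF Pm[OF x y]] f'[OF x] f'[OF y] by (simp add: power_add)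
    }
    fix y assume y: "[y = x] (mod N)"
    show "y \<in> K'" using Pc[OF x y] by (auto simp: K'_def)
    show "f' y = f' x" unfolding f'[OF x] f'[OF Pc[OF x y]] ..
  qed
  moreover have "K \<subseteq> K'" using PK by (auto simp: K'_def)
  moreover have "h \<in> K'" using Ph by (auto simp: K'_def)
  moreover have "f' h = z" using f'[OF Ph] pchar_one(2)[OF p] by simp
  moreover have "\<forall>x\<in>K. f' x = f x" using f'[OF PK] by simp
  ultimately show ?thesis by blast
qed

lemma pchar_least_power:
  assumes "pchar N K f" "N > 0" "coprime h N"
  obtains e where "e > 0" "h ^ e \<in> K" "\<And>i. 0 < i \<Longrightarrow> i < e \<Longrightarrow> h ^ i \<notin> K"
proof -
  define Q where "Q e \<longleftrightarrow> e > 0 \<and> h ^ e \<in> K" for e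
  have "h ^ totient N \<in> K"
    using pchar_cong(1)[OF assms(1) pchar_one(1)[OF assms(1)] euler_theorem[OF assms(3)]] .
  then have "Q (totient N)" using assms(2) by (simp add: Q_def)
  then have "Q (LEAST e. Q e)" by (rule LeastI)
  moreover have "\<not> Q i" if "i < (LEAST e. Q e)" for i using that by (rule not_less_Least)
  ultimately show ?thesis using that[of "LEAST e. Q e"] unfolding Q_def by blast
qed

lemma pchar_extend_all:
  assumes "pchar N K f" "N > 0"
  shows "\<exists>K' f'. pchar N K' f' \<and> (\<forall>x\<in>K. x \<in> K' \<and> f' x = f x) \<and> (\<forall>h<n. coprime h N \<longrightarrow> h \<in> K')"
proof (induction n)
  case 0
  show ?case using assms(1) by auto
next
  case (Suc n)
  then obtain K1 f1 where 1: "pchar N K1 f1" "\<forall>x\<in>K. x \<in> K1 \<and> f1 x = f x"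
    "\<forall>h<n. coprime h N \<longrightarrow> h \<in> K1" by blast
  show ?case
  proof (cases "coprime n N")
    case True
    obtain e where e: "e > 0" "n ^ e \<in> K1" "\<And>i. 0 < i \<Longrightarrow> i < e \<Longrightarrow> n ^ i \<notin> K1"
      using pchar_least_power[OF 1(1) assms(2) True] by blast
    define z where "z = exp (Ln (f1 (n ^ e)) / of_nat e)"
    have "z ^ e = exp (of_nat e * (Ln (f1 (n ^ e)) / of_nat e))"
      unfolding z_def by (rule exp_of_nat_mult [symmetric])
    then have "z ^ e = f1 (n ^ e)"
      using e(1) pchar_nonzero[OF 1(1) e(2) assms(2)] by (simp add: exp_Ln)
    from pchar_extend[OF 1(1) assms(2) True e this] show ?thesis
      using 1(2,3) by (metis less_antisym subset_iff)
  next
    case False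
    then show ?thesis using 1 by (metis less_antisym)
  qed
qed

text \<open>On the cyclic subgroup generated by \<open>a\<close>, of order \<open>e > 1\<close>, a primitive \<open>e\<close>-th root of unity is a
  possible value at \<open>a\<close>; the resulting character is extended to the whole unit group.\<close>

lemma dchars_separate:
  assumes N: "N > 0" and a: "coprime a N" "\<not> [a = 1] (mod N)"
  shows "\<exists>f\<in>dchars N. f a \<noteq> 1"
proof -
  define K where "K = {x. [x = 1] (mod N)}"
  have K: "pchar N K (\<lambda>_. 1)"
    unfolding pchar_def K_def
  proof (intro conjI ballI allI impI; (simp; fail)?)
    fix x assume x: "x \<in> {x. [x = 1] (mod N)}"
    then show "coprime x N" using cong_imp_coprime[of 1 x N] by (simp add: cong_sym)
    { fix y assume "y \<in> {x. [x = 1] (mod N)}"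
      then have "[x * y = 1 * 1] (mod N)" using x by (intro cong_mult) auto
      then show "x * y \<in> {x. [x = 1] (mod N)}" by simp }
    fix y assume "[y = x] (mod N)"
    then show "y \<in> {x. [x = 1] (mod N)}" using x by (auto intro: cong_trans)
  qed
  obtain e where e: "e > 0" "a ^ e \<in> K" "\<And>i. 0 < i \<Longrightarrow> i < e \<Longrightarrow> a ^ i \<notin> K"
    using pchar_least_power[OF K N a(1)] by blast
  have "e \<noteq> 1" using e(2) a(2) by (auto simp: K_def)
  define z :: complex where "z = exp (2 * complex_of_real pi * \<i> * of_nat 1 / of_nat e)"
  have "z \<noteq> 1" using e(1) \<open>e \<noteq> 1\<close> complex_root_unity_eq_1[of e 1] unfolding z_def by simp
  have "z ^ e = 1"
    unfolding z_def by (rule complex_root_unity) (use e(1) in simp)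
  then obtain K1 f1 where 1: "pchar N K1 f1" "a \<in> K1" "f1 a = z"
    using pchar_extend[OF K N a(1) e, of z] by blast
  obtain K2 f2 where 2: "pchar N K2 f2" "\<forall>x\<in>K1. x \<in> K2 \<and> f2 x = f1 x"
    "\<forall>h<N. coprime h N \<longrightarrow> h \<in> K2" using pchar_extend_all[OF 1(1) N] by blast
  have cop: "coprime x N \<longleftrightarrow> x \<in> K2" for x
  proof
    assume "coprime x N"
    then have "x mod N \<in> K2" using 2(3) N by (simp add: coprime_mod_left_iff)
    then show "x \<in> K2" using pchar_cong(1)[OF 2(1)] by (metis cong_mod_right cong_refl)
  qed (rule pchar_coprime[OF 2(1)])
  define f where "f x = (if coprime x N then f2 x else 0)" for x
  have "f \<in> dchars N"
    unfolding dchars_def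
  proof (intro CollectI conjI allI)
    show "f 1 = 1" using pchar_one(2)[OF 2(1)] by (simp add: f_def)
    show "f (m * n) = f m * f n" for m n
      using pchar_mult(2)[OF 2(1)] by (simp add: f_def cop[symmetric])
    show "f (n mod N) = f n" for n
      using pchar_cong(2)[OF 2(1), of n "n mod N"] N by (auto simp: f_def cop[symmetric] coprime_mod_left_iff)
    show "(f n = 0) = (\<not> coprime n N)" for n
      using pchar_nonzero[OF 2(1) _ N] by (auto simp: f_def cop)
  qed
  moreover have "f a \<noteq> 1" using 2(2) 1 a(1) \<open>z \<noteq> 1\<close> by (simp add: f_def)
  ultimately show ?thesis by blast
qed

lemma dchars_1: "f \<in> dchars N \<Longrightarrow> f (Suc 0) = 1"
  and dchars_mult: "f \<in> dchars N \<Longrightarrow> f (m * n) = f m * f n"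
  and dchars_mod: "f \<in> dchars N \<Longrightarrow> f (n mod N) = f n"
  and dchars_eq_0_iff: "f \<in> dchars N \<Longrightarrow> f n = 0 \<longleftrightarrow> \<not> coprime n N"
  unfolding dchars_def by auto

lemma dchars_cong: "f \<in> dchars N \<Longrightarrow> [m = n] (mod N) \<Longrightarrow> f m = f n"
  using dchars_mod[of f N m] dchars_mod[of f N n] by (simp add: cong_def)

lemma dchars_power: "f \<in> dchars N \<Longrightarrow> f (n ^ k) = f n ^ k"
  by (induction k) (simp_all add: dchars_1 dchars_mult)

lemma dchars_root_of_unity:
  assumes "f \<in> dchars N" "coprime n N"
  shows "f n ^ totient N = 1"
  using dchars_cong[OF assms(1) euler_theorem[OF assms(2)]] dchars_power[OF assms(1)] dchars_1[OF assms(1)]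
  by simp

lemma norm_dchars:
  assumes "f \<in> dchars N" "coprime n N" "N > 0"
  shows "norm (f n) = 1"
proof -
  have "norm (f n) ^ totient N = 1"
    using dchars_root_of_unity[OF assms(1,2)] by (metis norm_power norm_one)
  then show ?thesis using assms(3) power_eq_1_iff[of "norm (f n)" "totient N"] by auto
qed

lemma norm_dchars_le: "f \<in> dchars N \<Longrightarrow> N > 0 \<Longrightarrow> norm (f n) \<le> 1"
  using norm_dchars[of f N n] dchars_eq_0_iff[of f N n] by (cases "coprime n N") auto

lemma finite_dchars:
  assumes "N > 0"
  shows "finite (dchars N)"
proof -
  define V where "V = insert 0 {z :: complex. z ^ totient N = 1}"
  have "finite {z :: complex. z ^ totient N = 1}"
    using assms by (intro finite_roots_unity) (simp add: Suc_le_eq)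
  then have "finite ({..<N} \<rightarrow>\<^sub>E V)" by (intro finite_PiE) (auto simp: V_def)
  moreover have "dchars N \<subseteq> (\<lambda>g n. g (n mod N)) ` ({..<N} \<rightarrow>\<^sub>E V)"
  proof
    fix f assume f: "f \<in> dchars N"
    have "f n \<in> V" for n
      using dchars_root_of_unity[OF f, of n] dchars_eq_0_iff[OF f, of n] by (auto simp: V_def)
    then have 1: "restrict f {..<N} \<in> {..<N} \<rightarrow>\<^sub>E V" by auto
    have 2: "f = (\<lambda>n. restrict f {..<N} (n mod N))"
      using assms dchars_mod[OF f] by auto
    show "f \<in> (\<lambda>g n. g (n mod N)) ` ({..<N} \<rightarrow>\<^sub>E V)"
      by (rule image_eqI[where x = "restrict f {..<N}"], rule 2, rule 1)
  qed
  ultimately show ?thesis by (metis finite_imageI finite_subset)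
qed

definition principal_char :: "nat \<Rightarrow> nat \<Rightarrow> complex" where
  "principal_char N n = (if coprime n N then 1 else 0)"

lemma principal_char_in_dchars: "N > 0 \<Longrightarrow> principal_char N \<in> dchars N"
  unfolding dchars_def principal_char_def by (auto simp: coprime_mod_left_iff)

lemma dchars_times:
  assumes "f \<in> dchars N" "g \<in> dchars N"
  shows "(\<lambda>n. f n * g n) \<in> dchars N"
  using assms unfolding dchars_def by auto

lemma dchars_cnj:
  assumes "f \<in> dchars N"
  shows "(\<lambda>n. cnj (f n)) \<in> dchars N"
  using assms unfolding dchars_def by auto

lemma dchars_times_cnj:
  assumes "f \<in> dchars N" "N > 0"
  shows "f n * cnj (f n) = principal_char N n"
  using norm_dchars[OF assms(1) _ assms(2), of n] dchars_eq_0_iff[OF assms(1), of n]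
  by (auto simp: principal_char_def complex_norm_square[symmetric])

lemma dchars_nonprincipal:
  assumes "f \<in> dchars N" "f \<noteq> principal_char N"
  shows "\<exists>a. coprime a N \<and> f a \<noteq> 1"
proof (rule ccontr)
  assume "\<not> ?thesis"
  then have "f n = principal_char N n" for n
    using dchars_eq_0_iff[OF assms(1), of n] by (auto simp: principal_char_def)
  then show False using assms(2) by auto
qed

text \<open>Multiplication by a unit \<open>a\<close> permutes the residues, so the sum is invariant under
  multiplication by \<open>f a \<noteq> 1\<close>.\<close>

lemma sum_dchars_period:
  assumes f: "f \<in> dchars N" "f \<noteq> principal_char N" and N: "N > 0"
  shows "(\<Sum>n<N. f n) = 0"
proof -
  obtain a where a: "coprime a N" "f a \<noteq> 1" using dchars_nonprincipal[OF f] by blast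
  have inj: "inj_on (\<lambda>n. a * n mod N) {..<N}"
  proof (rule inj_onI)
    fix x y assume xy: "x \<in> {..<N}" "y \<in> {..<N}" "a * x mod N = a * y mod N"
    then have "[x = y] (mod N)" using a(1) by (metis cong_def cong_mult_lcancel_nat)
    then show "x = y" using xy by (simp add: cong_def)
  qed
  moreover have "(\<lambda>n. a * n mod N) ` {..<N} \<subseteq> {..<N}" using N by auto
  ultimately have "bij_betw (\<lambda>n. a * n mod N) {..<N} {..<N}"
    by (simp add: bij_betw_def endo_inj_surj)
  then have "(\<Sum>n<N. f n) = (\<Sum>n<N. f (a * n mod N))" by (rule sum.reindex_bij_betw [symmetric])
  also have "\<dots> = f a * (\<Sum>n<N. f n)"
    by (simp add: dchars_mod[OF f(1)] dchars_mult[OF f(1)] sum_distrib_left)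
  finally show ?thesis using a(2) by simp
qed

lemma norm_sum_dchars_le:
  assumes f: "f \<in> dchars N" "f \<noteq> principal_char N" and N: "N > 0"
  shows "norm (\<Sum>n<k. f n) \<le> real N"
proof -
  have per: "(\<Sum>i<r. f (q * N + i)) = (\<Sum>i<r. f i)" for q r
    by (intro sum.cong refl dchars_cong[OF f(1)]) (simp add: cong_def)
  have zero: "(\<Sum>n<q * N. f n) = 0" for q
  proof (induction q)
    case (Suc q)
    have "(\<Sum>n<Suc q * N. f n) = (\<Sum>n<q * N. f n) + (\<Sum>i<N. f (q * N + i))"
      using sum.atLeastLessThan_concat[of 0 "q * N" "Suc q * N" f]
            sum.shift_bounds_nat_ivl[of f 0 "q * N" N]
      by (simp add: lessThan_atLeast0 add.commute)
    then show ?case using Suc per sum_dchars_period[OF f N] by simp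
  qed simp
  define q r where "q = k div N" and "r = k mod N"
  have k: "k = q * N + r" by (simp add: q_def r_def)
  have "(\<Sum>n<k. f n) = (\<Sum>n<q * N. f n) + (\<Sum>i<r. f (q * N + i))"
    using sum.atLeastLessThan_concat[of 0 "q * N" "q * N + r" f]
          sum.shift_bounds_nat_ivl[of f 0 "q * N" r]
    by (simp add: k lessThan_atLeast0 add.commute)
  then have "(\<Sum>n<k. f n) = (\<Sum>i<r. f i)" by (simp add: zero per)
  also have "norm \<dots> \<le> (\<Sum>i<r. 1)"
    using norm_dchars_le[OF f(1) N] by (intro sum_norm_le) auto
  also have "\<dots> \<le> real N" using N by (simp add: r_def less_imp_le)
  finally show ?thesis .
qed

text \<open>Multiplication by a character \<open>g\<close> with \<open>g n \<noteq> 1\<close> permutes the characters.\<close>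

lemma sum_over_dchars:
  assumes N: "N > 0" and n: "coprime n N"
  shows "(\<Sum>f\<in>dchars N. f n) = (if [n = 1] (mod N) then of_nat (card (dchars N)) else 0)"
proof (cases "[n = 1] (mod N)")
  case True
  then have "f n = 1" if "f \<in> dchars N" for f using dchars_cong[OF that True] dchars_1[OF that] by simp
  then have "(\<Sum>f\<in>dchars N. f n) = (\<Sum>f\<in>dchars N. 1)" by (intro sum.cong) auto
  then show ?thesis using True by simp
next
  case False
  obtain g where g: "g \<in> dchars N" "g n \<noteq> 1" using dchars_separate[OF N n False] by blast
  have fix0: "f m * principal_char N m = f m" if "f \<in> dchars N" for f m
    using dchars_eq_0_iff[OF that, of m] by (simp add: principal_char_def)
  have "(\<Sum>f\<in>dchars N. f n) = (\<Sum>f\<in>dchars N. g n * f n)"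
  proof (rule sum.reindex_bij_witness[where i = "\<lambda>f m. g m * f m" and j = "\<lambda>f m. cnj (g m) * f m"])
    fix f assume f: "f \<in> dchars N"
    have *: "g m * (cnj (g m) * f m) = f m" for m
      using dchars_times_cnj[OF g(1) N, of m] fix0[OF f, of m] by (metis mult.assoc mult.commute)
    show "(\<lambda>m. g m * (cnj (g m) * f m)) = f" by (rule ext) (rule *)
    show "g n * (cnj (g n) * f n) = f n" by (rule *)
    show "(\<lambda>m. cnj (g m) * (g m * f m)) = f" by (rule ext, subst mult.left_commute, rule *)
    show "(\<lambda>m. cnj (g m) * f m) \<in> dchars N" by (rule dchars_times[OF dchars_cnj[OF g(1)] f])
    show "(\<lambda>m. g m * f m) \<in> dchars N" by (rule dchars_times[OF g(1) f])
  qed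
  also have "\<dots> = g n * (\<Sum>f\<in>dchars N. f n)" by (rule sum_distrib_left [symmetric])
  finally have "(\<Sum>f\<in>dchars N. f n) = g n * (\<Sum>f\<in>dchars N. f n)" .
  then show ?thesis using g(2) False by simp
qed

lemma sum_dchars_cnj:
  assumes N: "N > 0" and r: "coprime r N"
  shows "(\<Sum>f\<in>dchars N. cnj (f r) * f n) = (if [n = r] (mod N) then of_nat (card (dchars N)) else 0)"
proof -
  obtain r' where r': "[r * r' = 1] (mod N)" using cong_solve_coprime_nat[OF r] by auto
  then have cop: "coprime r' N"
    by (metis coprime_1_left cong_imp_coprime cong_sym coprime_mult_left_iff)
  have "cnj (f r) = f r'" if "f \<in> dchars N" for f
  proof -
    have "f r * f r' = 1" using dchars_cong[OF that r'] dchars_1[OF that] dchars_mult[OF that] by simp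
    moreover have "f r * cnj (f r) = 1" using dchars_times_cnj[OF that N, of r] r by (simp add: principal_char_def)
    ultimately show ?thesis by (metis mult_cancel_left mult_zero_left zero_neq_one)
  qed
  then have eq: "(\<Sum>f\<in>dchars N. cnj (f r) * f n) = (\<Sum>f\<in>dchars N. f (r' * n))"
    by (intro sum.cong) (auto simp: dchars_mult)
  show ?thesis
  proof (cases "coprime n N")
    case True
    have "[r' * n = 1] (mod N) \<longleftrightarrow> [n = r] (mod N)"
    proof
      assume "[r' * n = 1] (mod N)"
      then have "[r' * n = r' * r] (mod N)" using r' by (metis cong_sym cong_trans mult.commute)
      then show "[n = r] (mod N)" using cop by (metis cong_mult_lcancel_nat)
    next
      assume "[n = r] (mod N)"
      then have "[r' * n = r' * r] (mod N)" by (intro cong_mult cong_refl)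
      then show "[r' * n = 1] (mod N)" using r' by (metis cong_trans mult.commute)
    qed
    then show ?thesis unfolding eq using sum_over_dchars[OF N, of "r' * n"] True cop by simp
  next
    case False
    then have "\<not> [n = r] (mod N)" using r by (metis cong_imp_coprime cong_sym)
    moreover have "(\<Sum>f\<in>dchars N. f (r' * n)) = 0"
      using False by (intro sum.neutral) (auto simp: dchars_eq_0_iff)
    ultimately show ?thesis unfolding eq by simp
  qed
qed

section \<open>Partial summation\<close>

text \<open>Abel summation: the total variation of a decreasing nonnegative weight is at most its first value.\<close>

lemma sum_by_parts_bound:
  fixes c :: "nat \<Rightarrow> complex" and g :: "nat \<Rightarrow> real"
  assumes B: "\<And>n. norm (\<Sum>i<n. c i) \<le> B"
    and mono: "\<And>n. k \<le> n \<Longrightarrow> g (Suc n) \<le> g n" and nonneg: "\<And>n. k \<le> n \<Longrightarrow> 0 \<le> g n"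
  shows "norm (\<Sum>n=k..<l. c n * of_real (g n)) \<le> 2 * B * g k"
proof (cases "k \<le> l")
  case True
  define Q where "Q n = (\<Sum>i=k..<n. c i)" for n
  have Q: "norm (Q n) \<le> 2 * B" if "k \<le> n" for n
  proof -
    have "Q n = (\<Sum>i<n. c i) - (\<Sum>i<k. c i)"
      using sum.atLeastLessThan_concat[of 0 k n c] that by (simp add: Q_def lessThan_atLeast0 algebra_simps)
    then show ?thesis using norm_triangle_ineq4[of "\<Sum>i<n. c i" "\<Sum>i<k. c i"] B[of n] B[of k] by simp
  qed
  have eq: "(\<Sum>n=k..<l. c n * of_real (g n))
      = Q l * of_real (g l) + (\<Sum>n=k..<l. Q (Suc n) * of_real (g n - g (Suc n)))"
    using True
  proof (induction l rule: dec_induct)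
    case base
    show ?case by (simp add: Q_def)
  next
    case (step n)
    have "Q (Suc n) = Q n + c n" using step(1) by (simp add: Q_def)
    then show ?case using step by (simp add: algebra_simps)
  qed
  have "norm (\<Sum>n=k..<l. c n * of_real (g n))
      \<le> norm (Q l * of_real (g l)) + norm (\<Sum>n=k..<l. Q (Suc n) * of_real (g n - g (Suc n)))"
    unfolding eq by (rule norm_triangle_ineq)
  also have "norm (Q l * of_real (g l)) \<le> 2 * B * g l"
    using Q[OF True] nonneg[OF True] by (simp add: norm_mult mult_right_mono)
  also have "norm (\<Sum>n=k..<l. Q (Suc n) * of_real (g n - g (Suc n)))
      \<le> (\<Sum>n=k..<l. 2 * B * (g n - g (Suc n)))"
  proof (rule sum_norm_le)
    fix n assume "n \<in> {k..<l}"
    then show "norm (Q (Suc n) * of_real (g n - g (Suc n))) \<le> 2 * B * (g n - g (Suc n))"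
      using Q[of "Suc n"] mono[of n] by (simp add: norm_mult mult_right_mono del: of_real_diff)
  qed
  also have "(\<Sum>n=k..<l. 2 * B * (g n - g (Suc n))) = 2 * B * (g k - g l)"
    using sum_Suc_diff'[OF True, of "\<lambda>n. - g n"] by (simp flip: sum_distrib_left)
  finally show ?thesis by (simp add: algebra_simps)
next
  case False
  have "0 \<le> B" using B[of 0] by simp
  then show ?thesis using False nonneg[of k] by simp
qed

section \<open>Sums over divisors\<close>

text \<open>Both sides run over the pairs \<open>(d, m)\<close> with \<open>d m \<le> x\<close>.\<close>

lemma sum_divisors_swap:
  fixes x :: nat
  shows "(\<Sum>n=1..x. \<Sum>d | d dvd n. g d (n div d)) = (\<Sum>d=1..x. \<Sum>m=1..x div d. g d m)"
proof -
  have fin: "finite {d. d dvd n}" if "n \<in> {1..x}" for n :: nat using that finite_divisors_nat[of n] by simp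
  have le: "m \<le> x div d \<longleftrightarrow> d * m \<le> x" if "d > 0" for d m
    using that by (simp add: less_eq_div_iff_mult_less_eq mult.commute)
  have le2: "d \<le> x" if "d * m \<le> x" "m > 0" for d m :: nat
    using that by (cases m) auto
  have "(\<Sum>n=1..x. \<Sum>d | d dvd n. g d (n div d)) = (\<Sum>(n, d)\<in>(SIGMA n:{1..x}. {d. d dvd n}). g d (n div d))"
    using fin by (subst sum.Sigma) auto
  also have "\<dots> = (\<Sum>(d, m)\<in>(SIGMA d:{1..x}. {1..x div d}). g d m)"
    by (rule sum.reindex_bij_witness[where i = "\<lambda>(d, m). (d * m, d)" and j = "\<lambda>(n, d). (d, n div d)"])
       (auto simp: le Suc_le_eq div_le_mono dvd_div_eq_0_iff elim!: dvdE dest: dvd_imp_le le2)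
  also have "\<dots> = (\<Sum>d=1..x. \<Sum>m=1..x div d. g d m)"
    by (subst sum.Sigma) auto
  finally show ?thesis .
qed

lemma sum_divisors_nested_swap:
  fixes n :: nat
  assumes "n > 0"
  shows "(\<Sum>d | d dvd n. \<Sum>e | e dvd n div d. h d e) = (\<Sum>e | e dvd n. \<Sum>d | d dvd n div e. h d e)"
proof -
  have fin: "finite {d. d dvd n}" "\<And>d. d dvd n \<Longrightarrow> finite {e. e dvd n div d}"
    using assms by (auto simp: dvd_div_eq_0_iff)
  have "(\<Sum>d | d dvd n. \<Sum>e | e dvd n div d. h d e) = (\<Sum>(d, e)\<in>(SIGMA d:{d. d dvd n}. {e. e dvd n div d}). h d e)"
    using fin by (subst sum.Sigma) auto
  also have "\<dots> = (\<Sum>(e, d)\<in>(SIGMA e:{e. e dvd n}. {d. d dvd n div e}). h d e)"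
    by (rule sum.reindex_bij_witness[where i = "\<lambda>(e, d). (d, e)" and j = "\<lambda>(d, e). (e, d)"])
       (use assms in \<open>auto elim!: dvdE\<close>)
  also have "\<dots> = (\<Sum>e | e dvd n. \<Sum>d | d dvd n div e. h d e)"
    using fin by (subst sum.Sigma) auto
  finally show ?thesis .
qed

lemma sum_divisors_prime_power_mult:
  fixes p m :: nat
  assumes "prime p" "\<not> p dvd m" "m > 0"
  shows "(\<Sum>d | d dvd p ^ k * m. h d) = (\<Sum>i\<le>k. \<Sum>d | d dvd m. h (p ^ i * d))"
proof -
  have p0: "p > 0" using assms(1) prime_gt_0_nat by blast
  have mult: "multiplicity p (p ^ i * d) = i" if "d dvd m" for i d
    using that assms by (intro multiplicity_eqI) (auto dest: dvd_trans simp: p0)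
  have "(\<Sum>i\<le>k. \<Sum>d | d dvd m. h (p ^ i * d)) = (\<Sum>(i, d)\<in>{..k} \<times> {d. d dvd m}. h (p ^ i * d))"
    by (rule sum.cartesian_product)
  also have "\<dots> = (\<Sum>d | d dvd p ^ k * m. h d)"
  proof (rule sum.reindex_bij_witness[where j = "\<lambda>(i, d). p ^ i * d"
        and i = "\<lambda>d. (multiplicity p d, d div p ^ multiplicity p d)"])
    fix a assume "a \<in> {..k} \<times> {d. d dvd m}"
    then obtain i d where a: "a = (i, d)" "i \<le> k" "d dvd m" by auto
    then show "(multiplicity p (case a of (i, d) \<Rightarrow> p ^ i * d),
        (case a of (i, d) \<Rightarrow> p ^ i * d) div p ^ multiplicity p (case a of (i, d) \<Rightarrow> p ^ i * d)) = a"
      using mult p0 by simp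
    show "(case a of (i, d) \<Rightarrow> p ^ i * d) \<in> {d. d dvd p ^ k * m}"
      using a by (auto intro: mult_dvd_mono le_imp_power_dvd)
    show "h (case a of (i, d) \<Rightarrow> p ^ i * d) = (case a of (i, d) \<Rightarrow> h (p ^ i * d))" by (simp add: a)
  next
    fix d assume "d \<in> {d. d dvd p ^ k * m}"
    then have d: "d dvd p ^ k * m" by simp
    have d0: "d \<noteq> 0"
    proof
      assume "d = 0"
      then have "p ^ k * m = 0" using d by (simp only: dvd_0_left_iff)
      then show False using assms(3) p0 by simp
    qed
    define i where "i = multiplicity p d"
    show "(case (multiplicity p d, d div p ^ multiplicity p d) of (i, d) \<Rightarrow> p ^ i * d) = d"
      by (simp add: multiplicity_dvd)
    obtain d' where d': "d = p ^ i * d'" "\<not> p dvd d'"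
      using multiplicity_decompose'[of d p] d0 assms(1) unfolding i_def by (metis not_prime_unit)
    have "i \<le> multiplicity p (p ^ k * m)"
      unfolding i_def by (rule dvd_imp_multiplicity_le[OF d]) (use assms p0 in auto)
    then have "i \<le> k" using mult[of m k] by simp
    moreover have "d' dvd m"
    proof -
      have "d' dvd p ^ k * m" using d d'(1) by (metis dvd_mult_right)
      moreover have "coprime d' (p ^ k)"
        using prime_imp_coprime[OF assms(1) d'(2)] by (simp add: coprime_commute)
      ultimately show ?thesis by (metis coprime_dvd_mult_right_iff)
    qed
    moreover have "d div p ^ i = d'" using d'(1) p0 by simp
    ultimately show "(multiplicity p d, d div p ^ multiplicity p d) \<in> {..k} \<times> {d. d dvd m}"
      by (simp flip: i_def)
  qed
  finally show ?thesis ..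
qed

lemma prime_power_split:
  fixes n :: nat
  assumes "n > 1"
  obtains p k m where "prime p" "k > 0" "\<not> p dvd m" "n = p ^ k * m" "0 < m" "m < n"
proof -
  obtain p where p: "prime p" "p dvd n" using assms prime_factor_nat[of n] by auto
  define k where "k = multiplicity p n"
  obtain m where m: "n = p ^ k * m" "\<not> p dvd m"
    using multiplicity_decompose'[of n p] assms p(1) unfolding k_def by (metis not_prime_unit not_one_less_zero gr_implies_not0)
  have k: "k > 0" using p m by (cases k) auto
  moreover have "m > 0" using m(1) assms by (cases m) auto
  moreover have "m < n" using \<open>m > 0\<close> k prime_gt_1_nat[OF p(1)] one_less_power[of p k] by (simp add: m(1))
  ultimately show ?thesis using that p(1) m by blast
qed

lemma divide_le_div_plus_1: "real x / real d \<le> real (x div d) + 1"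
proof (cases "d = 0")
  case False
  then have "x \<le> d + x div d * d" using dividend_less_div_times[of d x] by simp
  then have "real x \<le> real (d + x div d * d)" by (simp only: of_nat_le_iff)
  then show ?thesis using False by (simp add: field_simps)
qed simp

section \<open>Estimates of Chebyshev and Mertens\<close>

lemma ln_fact_eq_sum: "ln (fact x) = (\<Sum>n=1..x. ln (real n))"
  by (induction x) (simp_all add: ln_mult)

lemma ln_fact_eq_mangoldt: "ln (fact x) = (\<Sum>d=1..x. mangoldt d * real (x div d))"
proof -
  have "ln (fact x) = (\<Sum>n=1..x. \<Sum>d | d dvd n. mangoldt d :: real)"
    unfolding ln_fact_eq_sum by (intro sum.cong refl) (simp add: mangoldt_sum)
  also have "\<dots> = (\<Sum>d=1..x. \<Sum>m=1..x div d. mangoldt d :: real)"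
    by (rule sum_divisors_swap[where g = "\<lambda>d _. mangoldt d"])
  finally show ?thesis by (simp add: mult.commute)
qed

lemma ln_fact_le: "ln (fact x) \<le> real x * ln (real x)"
proof -
  have "(\<Sum>n=1..x. ln (real n)) \<le> (\<Sum>n=1..x. ln (real x))"
    by (intro sum_mono) auto
  then show ?thesis by (simp add: ln_fact_eq_sum)
qed

lemma ln_fact_ge: "ln (fact x) \<ge> real x * ln (real x) - real x"
proof (induction x)
  case 0
  then show ?case by simp
next
  case (Suc x)
  show ?case
  proof (cases "x = 0")
    case False
    have "ln (real (Suc x)) - ln (real x) = ln (real (Suc x) / real x)"
      using False by (simp add: ln_div del: of_nat_Suc)
    also have "real (Suc x) / real x = 1 + 1 / real x" using False by (simp add: field_simps)
    also have "ln \<dots> \<le> 1 / real x" using False by (intro ln_add_one_self_le_self) auto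
    finally have "real x * (ln (real (Suc x)) - ln (real x)) \<le> 1"
      using False by (simp add: field_simps)
    moreover have "ln (fact (Suc x) :: real) = ln (real (Suc x)) + ln (fact x)"
      by (simp add: ln_mult del: of_nat_Suc)
    ultimately show ?thesis using Suc by (simp add: algebra_simps)
  qed simp
qed

definition psi :: "nat \<Rightarrow> real" where
  "psi x = (\<Sum>d=1..x. mangoldt d)"

lemma psi_mono: "x \<le> y \<Longrightarrow> psi x \<le> psi y"
  unfolding psi_def by (intro sum_mono2) (auto intro: mangoldt_nonneg)

text \<open>The central binomial coefficient is at most \<open>4 ^ n\<close>, and in its logarithm each \<open>\<Lambda> d\<close> with
  \<open>n < d \<le> 2 n\<close> occurs with weight one, while no weight is negative.\<close>

lemma psi_double: "psi (2 * n) - psi n \<le> real (2 * n) * ln 2"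
proof -
  have n: "ln (fact n) = (\<Sum>d=1..2*n. mangoldt d * real (n div d))"
    unfolding ln_fact_eq_mangoldt by (intro sum.mono_neutral_left) auto
  have "ln (fact (2 * n)) - 2 * ln (fact n)
      = (\<Sum>d=1..2*n. mangoldt d * (real (2 * n div d) - 2 * real (n div d)))"
    unfolding n ln_fact_eq_mangoldt[of "2 * n"]
    by (simp add: sum_distrib_left right_diff_distrib sum_subtractf mult_ac)
  moreover have "psi (2 * n) - psi n = (\<Sum>d\<in>{n<..2*n}. mangoldt d)"
  proof -
    have eq: "{1..2*n} = {1..n} \<union> {n<..2*n}" by auto
    have "sum mangoldt ({1..n} \<union> {n<..2*n}) = sum mangoldt {1..n} + (sum mangoldt {n<..2*n} :: real)"
      by (rule sum.union_disjoint) auto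
    then show ?thesis unfolding psi_def eq by simp
  qed
  moreover have "(\<Sum>d\<in>{n<..2*n}. mangoldt d)
      \<le> (\<Sum>d\<in>{n<..2*n}. mangoldt d * (real (2 * n div d) - 2 * real (n div d)))"
  proof (intro sum_mono)
    fix d assume d: "d \<in> {n<..2*n}"
    then have "2 * n div d = 1" by (intro div_nat_eqI) auto
    then show "mangoldt d \<le> mangoldt d * (real (2 * n div d) - 2 * real (n div d))" using d by simp
  qed
  moreover have "\<dots> \<le> (\<Sum>d=1..2*n. mangoldt d * (real (2 * n div d) - 2 * real (n div d)))"
  proof (intro sum_mono2)
    fix d :: nat
    have "2 * (n div d) \<le> 2 * n div d" by (metis div_mult2_eq div_mult_mult1_if times_div_less_eq_dividend mult.commute div_mult1_eq le_add1)
    then have "2 * real (n div d) \<le> real (2 * n div d)"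
      by (metis of_nat_le_iff of_nat_mult of_nat_numeral)
    then show "0 \<le> mangoldt d * (real (2 * n div d) - 2 * real (n div d))"
      by (intro mult_nonneg_nonneg mangoldt_nonneg) simp
  qed auto
  moreover have "ln (fact (2 * n)) - 2 * ln (fact n) = ln (real (2 * n choose n))"
  proof -
    have "(fact (2 * n) :: real) = fact n * fact n * real (2 * n choose n)"
      using binomial_fact_lemma[of n "2 * n"] by (metis (no_types, lifting) le_add1 mult_2 add_diff_cancel_left' of_nat_fact of_nat_mult)
    then have "ln (fact (2 * n) :: real) = ln (fact n) + ln (fact n) + ln (real (2 * n choose n))"
      by (simp add: ln_mult)
    then show ?thesis by simp
  qed
  moreover have "ln (real (2 * n choose n)) \<le> ln (2 ^ (2 * n))"
  proof (subst ln_le_cancel_iff)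
    have "2 * n choose n \<le> 2 ^ (2 * n)" by (rule binomial_le_pow2)
    then show "real (2 * n choose n) \<le> 2 ^ (2 * n)" by (metis of_nat_le_iff of_nat_numeral of_nat_power)
  qed auto
  ultimately show ?thesis by (simp add: ln_realpow)
qed

lemma psi_le: "psi x \<le> 4 * real x"
proof (cases "x = 0")
  case True
  then show ?thesis by (simp add: psi_def)
next
  case False
  have pow: "psi (2 ^ k) \<le> 2 ^ Suc k * ln 2" for k
  proof (induction k)
    case 0
    show ?case by (simp add: psi_def)
  next
    case (Suc k)
    then show ?case using psi_double[of "2 ^ k"] by (simp add: algebra_simps)
  qed
  obtain k where k: "2 ^ k \<le> x" "x < 2 ^ (k + 1)" using ex_power_ivl1[of 2 x] False by auto
  have "psi x \<le> psi (2 ^ Suc k)" using k(2) by (intro psi_mono) simp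
  also have "\<dots> \<le> 2 ^ Suc (Suc k) * ln 2" by (rule pow)
  also have "\<dots> \<le> 2 ^ Suc (Suc k) * 1" using ln_2_less_1 by (intro mult_left_mono) auto
  also have "\<dots> = 4 * real (2 ^ k)" by simp
  also have "\<dots> \<le> 4 * real x" using k(1) by (intro mult_left_mono) (simp_all only: of_nat_le_iff)
  finally show ?thesis .
qed

lemma mertens_ge:
  assumes "x > 0"
  shows "(\<Sum>d=1..x. mangoldt d / real d) \<ge> ln (real x) - 1"
proof -
  have "ln (fact x) \<le> (\<Sum>d=1..x. mangoldt d * (real x / real d))"
    unfolding ln_fact_eq_mangoldt by (intro sum_mono mult_left_mono mangoldt_nonneg of_nat_div_le_of_nat)
  also have "\<dots> = real x * (\<Sum>d=1..x. mangoldt d / real d)" by (simp add: sum_distrib_left mult_ac)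
  finally have "real x * (ln (real x) - 1) \<le> real x * (\<Sum>d=1..x. mangoldt d / real d)"
    using ln_fact_ge[of x] by (simp add: algebra_simps)
  then show ?thesis using assms by simp
qed

text \<open>Replacing \<open>\<lfloor>x/d\<rfloor>\<close> by \<open>x/d\<close> in the formula for \<open>ln (x!)\<close> costs at most \<open>psi x\<close>, which is where
  Chebyshev's bound enters.\<close>

lemma mertens_le:
  assumes "x > 0"
  shows "(\<Sum>d=1..x. mangoldt d / real d) \<le> ln (real x) + 4"
proof -
  have "real x * (\<Sum>d=1..x. mangoldt d / real d) - psi x = (\<Sum>d=1..x. mangoldt d * (real x / real d - 1))"
    by (simp add: psi_def sum_distrib_left right_diff_distrib sum_subtractf mult_ac)
  also have "\<dots> \<le> (\<Sum>d=1..x. mangoldt d * real (x div d))"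
  proof (intro sum_mono mult_left_mono mangoldt_nonneg)
    fix d :: nat
    show "real x / real d - 1 \<le> real (x div d)"
      using divide_le_div_plus_1[of x d] by linarith
  qed
  also have "\<dots> \<le> real x * ln (real x)" using ln_fact_le[of x] by (simp add: ln_fact_eq_mangoldt)
  finally have "real x * (\<Sum>d=1..x. mangoldt d / real d) \<le> real x * (ln (real x) + 4)"
    using psi_le[of x] by (simp add: algebra_simps)
  then show ?thesis using assms by simp
qed

section \<open>The series of a character at 1\<close>

definition partial_L :: "(nat \<Rightarrow> complex) \<Rightarrow> nat \<Rightarrow> complex" where
  "partial_L f k = (\<Sum>m=1..k. f m / of_nat m)"

text \<open>Stating the value of the series at 1 together with this rate of convergence avoids separate limit arguments:
  applied at \<open>\<lfloor>x/d\<rfloor>\<close> it gives an error proportional to \<open>d/x\<close>.\<close>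

definition has_L :: "nat \<Rightarrow> (nat \<Rightarrow> complex) \<Rightarrow> complex \<Rightarrow> bool" where
  "has_L N f L \<longleftrightarrow> (\<forall>k. norm (partial_L f k - L) \<le> 2 * real N / real (k + 1))"

lemma norm_partial_L_diff:
  assumes f: "f \<in> dchars N" "f \<noteq> principal_char N" and N: "N > 0" and kl: "k \<le> l"
  shows "norm (partial_L f l - partial_L f k) \<le> 2 * real N / real (k + 1)"
proof -
  have "{1..l} = {1..k} \<union> {Suc k..<Suc l}" using kl by auto
  then have "partial_L f l = partial_L f k + (\<Sum>m=Suc k..<Suc l. f m / of_nat m)"
    unfolding partial_L_def by (simp only:) (rule sum.union_disjoint; auto)
  then have "partial_L f l - partial_L f k = (\<Sum>m=Suc k..<Suc l. f m / of_nat m)" by simp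
  also have "\<dots> = (\<Sum>m=Suc k..<Suc l. f m * of_real (1 / real m))"
    by (intro sum.cong) simp_all
  also have "norm \<dots> \<le> 2 * real N * (1 / real (Suc k))"
    by (rule sum_by_parts_bound[OF norm_sum_dchars_le[OF f N]]) (auto simp: divide_simps)
  finally show ?thesis by simp
qed

lemma has_L_exists:
  assumes f: "f \<in> dchars N" "f \<noteq> principal_char N" and N: "N > 0"
  obtains L where "has_L N f L"
proof -
  have lim0: "(\<lambda>k. 2 * real N / real (k + 1)) \<longlonglongrightarrow> 0"
    using LIMSEQ_inverse_real_of_nat[THEN tendsto_mult_right, of "2 * real N"]
    by (simp add: field_simps)
  have "Cauchy (partial_L f)"
  proof (rule CauchyI)
    fix e :: real assume "e > 0"
    then have "\<forall>\<^sub>F k in sequentially. 2 * real N / real (k + 1) < e / 2"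
      using order_tendstoD(2)[OF lim0, of "e / 2"] by simp
    then obtain k where k: "2 * real N / real (k + 1) < e / 2"
      unfolding eventually_sequentially by blast
    have *: "norm (partial_L f m - partial_L f k) < e / 2" if "k \<le> m" for m
      using norm_partial_L_diff[OF f N that] k by linarith
    have "norm (partial_L f m - partial_L f n) < e" if "k \<le> m" "k \<le> n" for m n
      using *[OF that(1)] *[OF that(2)]
        norm_triangle_ineq4[of "partial_L f m - partial_L f k" "partial_L f n - partial_L f k"] by simp
    then show "\<exists>M. \<forall>m\<ge>M. \<forall>n\<ge>M. norm (partial_L f m - partial_L f n) < e" by blast
  qed
  then have "convergent (partial_L f)" by (rule Cauchy_convergent)
  then obtain L where L: "partial_L f \<longlonglongrightarrow> L" unfolding convergent_def by blast
  have "norm (partial_L f k - L) \<le> 2 * real N / real (k + 1)" for k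
  proof -
    have "(\<lambda>l. norm (partial_L f l - partial_L f k)) \<longlonglongrightarrow> norm (L - partial_L f k)"
      by (intro tendsto_intros L)
    moreover have "\<forall>\<^sub>F l in sequentially. norm (partial_L f l - partial_L f k) \<le> 2 * real N / real (k + 1)"
      using eventually_ge_at_top[of k] by eventually_elim (rule norm_partial_L_diff[OF f N])
    ultimately have "norm (L - partial_L f k) \<le> 2 * real N / real (k + 1)"
      by (rule tendsto_upperbound) simp
    then show ?thesis by (subst norm_minus_commute)
  qed
  then show ?thesis using that unfolding has_L_def by blast
qed

lemma has_L_div:
  assumes "has_L N f L" "d > 0" "x > 0"
  shows "norm (partial_L f (x div d) - L) \<le> 2 * real N * real d / real x"
proof -
  have "norm (partial_L f (x div d) - L) \<le> 2 * real N / (real (x div d) + 1)"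
    using assms(1) unfolding has_L_def by (metis of_nat_1 of_nat_add)
  also have "\<dots> \<le> 2 * real N / (real x / real d)"
    using divide_le_div_plus_1[of x d] assms(2,3) by (intro divide_left_mono) auto
  finally show ?thesis by simp
qed

definition mangoldt_sum_char :: "(nat \<Rightarrow> complex) \<Rightarrow> nat \<Rightarrow> complex" where
  "mangoldt_sum_char f x = (\<Sum>d=1..x. f d * mangoldt d / of_nat d)"

lemma ln_over_id_decreasing:
  assumes "n \<ge> 3"
  shows "ln (real (Suc n)) / real (Suc n) \<le> ln (real n) / real n"
proof -
  have "exp 1 \<le> (3 :: real)" by (rule exp_le)
  also have "3 \<le> real n" using assms by simp
  finally have "exp 1 \<le> real n" .
  then have "1 \<le> ln (real n)" using assms by (subst ln_ge_iff) auto
  moreover have "ln (real (Suc n)) - ln (real n) \<le> 1 / real n"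
  proof -
    have "ln (real (Suc n)) - ln (real n) = ln (real (Suc n) / real n)"
      using assms by (simp add: ln_div del: of_nat_Suc)
    also have "real (Suc n) / real n = 1 + 1 / real n" using assms by (simp add: field_simps)
    also have "ln \<dots> \<le> 1 / real n" by (intro ln_add_one_self_le_self) auto
    finally show ?thesis .
  qed
  then have "real n * ln (real (Suc n)) - real n * ln (real n) \<le> 1"
    using assms by (simp add: field_simps)
  ultimately have "real n * ln (real (Suc n)) \<le> real (Suc n) * ln (real n)" by (simp add: algebra_simps)
  then show ?thesis using assms by (simp add: field_simps)
qed

lemma char_ln_sum_bounded:
  assumes f: "f \<in> dchars N" "f \<noteq> principal_char N" and N: "N > 0"
  shows "\<exists>C. \<forall>x. norm (\<Sum>n=1..x. f n * ln (real n) / of_nat n) \<le> C"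
proof -
  define g where "g n = ln (real n) / real n" for n
  have eq: "(\<Sum>n=1..x. f n * ln (real n) / of_nat n) = (\<Sum>n=1..x. f n * of_real (g n))" for x
    by (intro sum.cong) (simp_all add: g_def)
  have "norm (\<Sum>n=1..x. f n * of_real (g n)) \<le> (\<Sum>n\<in>{1,2}. \<bar>g n\<bar>) + 2 * real N * g 3" for x
  proof -
    have "{1..x} = ({1..x} \<inter> {1,2}) \<union> {3..<Suc x}" by auto
    then have "(\<Sum>n=1..x. f n * of_real (g n))
        = (\<Sum>n\<in>{1..x} \<inter> {1,2}. f n * of_real (g n)) + (\<Sum>n=3..<Suc x. f n * of_real (g n))"
      by (subst sum.union_disjoint [symmetric]) auto
    also have "norm \<dots> \<le> (\<Sum>n\<in>{1..x} \<inter> {1,2}. \<bar>g n\<bar>) + 2 * real N * g 3"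
    proof (intro order_trans[OF norm_triangle_ineq] add_mono)
      show "norm (\<Sum>n\<in>{1..x} \<inter> {1,2}. f n * of_real (g n)) \<le> (\<Sum>n\<in>{1..x} \<inter> {1,2}. \<bar>g n\<bar>)"
        using norm_dchars_le[OF f(1) N]
        by (intro sum_norm_le) (simp add: norm_mult mult_left_le_one_le)
      show "norm (\<Sum>n=3..<Suc x. f n * of_real (g n)) \<le> 2 * real N * g 3"
        by (rule sum_by_parts_bound[OF norm_sum_dchars_le[OF f N]])
           (auto simp: g_def simp del: of_nat_Suc intro: ln_over_id_decreasing)
    qed
    also have "(\<Sum>n\<in>{1..x} \<inter> {1,2}. \<bar>g n\<bar>) \<le> (\<Sum>n\<in>{1,2}. \<bar>g n\<bar>)" by (intro sum_mono2) auto
    finally show ?thesis by simp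
  qed
  then show ?thesis unfolding eq by blast
qed

text \<open>Since \<open>ln = \<Lambda> * 1\<close> as Dirichlet convolution, the bounded sum of \<open>f(n) ln n / n\<close> equals \<open>L\<close> times the sum
  in question, up to an error controlled by Chebyshev's bound.\<close>

lemma mangoldt_sum_char_bounded:
  assumes f: "f \<in> dchars N" "f \<noteq> principal_char N" and N: "N > 0" and L: "has_L N f L" "L \<noteq> 0"
  shows "\<exists>C. \<forall>x. norm (mangoldt_sum_char f x) \<le> C"
proof -
  obtain C where C: "\<And>x. norm (\<Sum>n=1..x. f n * ln (real n) / of_nat n) \<le> C"
    using char_ln_sum_bounded[OF f N] by blast
  have "norm (L * mangoldt_sum_char f x) \<le> C + 8 * real N" for x
  proof (cases "x = 0")
    case True
    then show ?thesis using C[of 0] by (simp add: mangoldt_sum_char_def)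
  next
    case False
    have "(\<Sum>n=1..x. f n * ln (real n) / of_nat n)
        = (\<Sum>n=1..x. \<Sum>d | d dvd n. f d * mangoldt d / of_nat d * (f (n div d) / of_nat (n div d)))"
    proof (rule sum.cong[OF refl])
      fix n assume "n \<in> {1..x}"
      then have n: "n \<noteq> 0" by auto
      have "f n * ln (real n) / of_nat n = (\<Sum>d | d dvd n. f n * mangoldt d / of_nat n)"
        by (simp add: mangoldt_sum[OF n, symmetric] sum_distrib_left sum_divide_distrib)
      also have "\<dots> = (\<Sum>d | d dvd n. f d * mangoldt d / of_nat d * (f (n div d) / of_nat (n div d)))"
      proof (rule sum.cong[OF refl])
        fix d assume "d \<in> {d. d dvd n}"
        then have "f n = f d * f (n div d)" "(of_nat n :: complex) = of_nat d * of_nat (n div d)"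
          using dchars_mult[OF f(1), of d "n div d"] of_nat_mult[of d "n div d", where 'a = complex]
          by simp_all
        then show "f n * mangoldt d / of_nat n = f d * mangoldt d / of_nat d * (f (n div d) / of_nat (n div d))"
          by simp
      qed
      finally show "f n * ln (real n) / of_nat n = (\<Sum>d | d dvd n. f d * mangoldt d / of_nat d * (f (n div d) / of_nat (n div d)))" .
    qed
    also have "\<dots> = (\<Sum>d=1..x. f d * mangoldt d / of_nat d * partial_L f (x div d))"
      unfolding partial_L_def sum_distrib_left
      by (rule sum_divisors_swap[where g = "\<lambda>d m. f d * mangoldt d / of_nat d * (f m / of_nat m)"])
    also have "\<dots> = L * mangoldt_sum_char f x
        + (\<Sum>d=1..x. f d * mangoldt d / of_nat d * (partial_L f (x div d) - L))"
      unfolding mangoldt_sum_char_def sum_distrib_left sum.distrib [symmetric]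
      by (intro sum.cong refl) (simp add: right_diff_distrib diff_divide_distrib mult.commute)
    finally have eq: "L * mangoldt_sum_char f x = (\<Sum>n=1..x. f n * ln (real n) / of_nat n)
        - (\<Sum>d=1..x. f d * mangoldt d / of_nat d * (partial_L f (x div d) - L))"
      by (simp only: eq_diff_eq)
    have "norm (L * mangoldt_sum_char f x) \<le> norm (\<Sum>n=1..x. f n * ln (real n) / of_nat n)
        + norm (\<Sum>d=1..x. f d * mangoldt d / of_nat d * (partial_L f (x div d) - L))"
      unfolding eq by (rule norm_triangle_ineq4)
    also have "norm (\<Sum>d=1..x. f d * mangoldt d / of_nat d * (partial_L f (x div d) - L))
        \<le> (\<Sum>d=1..x. 2 * real N / real x * mangoldt d)"
    proof (rule sum_norm_le)
      fix d assume d: "d \<in> {1..x}"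
      have "norm (f d * mangoldt d / of_nat d * (partial_L f (x div d) - L))
          = norm (f d) * (mangoldt d / real d * norm (partial_L f (x div d) - L))"
        by (simp add: norm_mult norm_divide)
      also have "\<dots> \<le> 1 * (mangoldt d / real d * (2 * real N * real d / real x))"
        using has_L_div[OF L(1), of d x] d
        by (intro mult_mono norm_dchars_le[OF f(1) N]) (auto intro!: mult_nonneg_nonneg divide_nonneg_nonneg mangoldt_nonneg)
      also have "\<dots> = 2 * real N / real x * mangoldt d" using d False by (simp add: field_simps)
      finally show "norm (f d * mangoldt d / of_nat d * (partial_L f (x div d) - L))
          \<le> 2 * real N / real x * mangoldt d" .
    qed
    also have "\<dots> = 2 * real N / real x * psi x" by (simp add: psi_def sum_distrib_left)
    also have "\<dots> \<le> 2 * real N / real x * (4 * real x)" by (intro mult_left_mono psi_le) auto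
    also have "\<dots> = 8 * real N" using False by simp
    finally show ?thesis using C[of x] by linarith
  qed
  then have "norm (mangoldt_sum_char f x) \<le> (C + 8 * real N) / norm L" for x
    using L(2) by (simp add: norm_mult field_simps)
  then show ?thesis by blast
qed

section \<open>Characters whose series vanishes at 1\<close>

definition mobius :: "nat \<Rightarrow> real" where
  "mobius n = (if squarefree n then (- 1) ^ card (prime_factors n) else 0)"

lemma mobius_1 [simp]: "mobius (Suc 0) = 1"
  by (simp add: mobius_def)

lemma abs_mobius_le: "\<bar>mobius n\<bar> \<le> 1"
  by (simp add: mobius_def power_abs)

lemma mobius_prime_mult:
  assumes "prime p" "\<not> p dvd d"
  shows "mobius (p * d) = - mobius d"
proof -
  have d: "d \<noteq> 0" using assms(2) by (metis dvd_0_right)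
  have "squarefree (p * d) \<longleftrightarrow> squarefree d"
    using squarefree_mult_coprime[OF prime_imp_coprime[OF assms] squarefree_prime[OF assms(1)]]
      squarefree_multD(2)[of p d] by blast
  moreover have "prime_factors (p * d) = insert p (prime_factors d)"
    using assms(1) d by (simp add: prime_factors_product prime_prime_factors prime_gt_0_nat)
  moreover have "p \<notin> prime_factors d" using assms(2) by (auto dest: in_prime_factors_imp_dvd)
  ultimately show ?thesis by (simp add: mobius_def)
qed

lemma mobius_prime_power_mult:
  assumes "prime p" "i \<ge> 2"
  shows "mobius (p ^ i * d) = 0"
proof -
  have "p\<^sup>2 dvd p ^ i * d" using assms(2) by (intro dvd_mult2 le_imp_power_dvd)
  then have "\<not> squarefree (p ^ i * d)"
    using assms(1) unfolding squarefree_def by (metis not_prime_unit)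
  then show ?thesis by (simp add: mobius_def)
qed

lemma sum_mobius:
  assumes "n > 0"
  shows "(\<Sum>d | d dvd n. mobius d) = (if n = 1 then 1 else 0)"
proof (cases "n = 1")
  case False
  then have "n > 1" using assms by simp
  then obtain p k m where p: "prime p" "k > 0" "\<not> p dvd m" "n = p ^ k * m" "0 < m" "m < n"
    by (rule prime_power_split)
  have "(\<Sum>d | d dvd n. mobius d) = (\<Sum>i\<le>k. \<Sum>d | d dvd m. mobius (p ^ i * d))"
    unfolding p(4) by (rule sum_divisors_prime_power_mult[OF p(1,3,5)])
  also have "\<dots> = (\<Sum>i\<le>1. \<Sum>d | d dvd m. mobius (p ^ i * d))"
    using p(2) mobius_prime_power_mult[OF p(1)] by (intro sum.mono_neutral_right) auto
  also have "\<dots> = (\<Sum>d | d dvd m. mobius d) + (\<Sum>d | d dvd m. mobius (p * d))"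
    by simp
  also have "(\<Sum>d | d dvd m. mobius (p * d)) = (\<Sum>d | d dvd m. - mobius d)"
    using p(3) by (intro sum.cong refl mobius_prime_mult[OF p(1)]) (auto dest: dvd_trans)
  finally show ?thesis using False by (simp add: sum_negf)
qed simp

text \<open>Moebius inversion of \<open>ln = \<Lambda> * 1\<close>.\<close>

lemma sum_mobius_ln:
  assumes "n > 0"
  shows "(\<Sum>d | d dvd n. mobius d * ln (real d)) = - mangoldt n"
proof -
  have "(\<Sum>d | d dvd n. mobius d * ln (real (n div d)))
      = (\<Sum>d | d dvd n. \<Sum>e | e dvd n div d. mobius d * mangoldt e)"
  proof (rule sum.cong[OF refl])
    fix d assume "d \<in> {d. d dvd n}"
    then have "n div d \<noteq> 0" using assms by (auto simp: dvd_div_eq_0_iff)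
    from mangoldt_sum[OF this, where ?'a = real]
    show "mobius d * ln (real (n div d)) = (\<Sum>e | e dvd n div d. mobius d * mangoldt e)"
      by (simp flip: sum_distrib_left)
  qed
  also have "\<dots> = (\<Sum>e | e dvd n. \<Sum>d | d dvd n div e. mobius d * mangoldt e)"
    by (rule sum_divisors_nested_swap[OF assms])
  also have "\<dots> = (\<Sum>e | e dvd n. if e = n then mangoldt n else 0)"
  proof (rule sum.cong[OF refl])
    fix e assume e: "e \<in> {e. e dvd n}"
    then have "n div e > 0" using assms by (intro Nat.gr0I) (auto simp: dvd_div_eq_0_iff)
    moreover have "n div e = 1 \<longleftrightarrow> e = n" using e assms by (auto elim!: dvdE)
    ultimately show "(\<Sum>d | d dvd n div e. mobius d * mangoldt e) = (if e = n then mangoldt n else 0)"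
      using sum_mobius[of "n div e"] by (simp flip: sum_distrib_right)
  qed
  also have "\<dots> = mangoldt n"
    using assms finite_divisors_nat[of n] by (subst sum.delta) auto
  finally have 1: "(\<Sum>d | d dvd n. mobius d * ln (real (n div d))) = mangoldt n" .
  have "(\<Sum>d | d dvd n. mobius d * ln (real (n div d))) + (\<Sum>d | d dvd n. mobius d * ln (real d))
      = (\<Sum>d | d dvd n. mobius d * ln (real n))"
    unfolding sum.distrib [symmetric]
  proof (rule sum.cong[OF refl])
    fix d assume d: "d \<in> {d. d dvd n}"
    then have "d > 0" "n div d > 0" using assms by (auto simp: dvd_div_eq_0_iff intro!: Nat.gr0I)
    then have "ln (real (n div d * d)) = ln (real (n div d)) + ln (real d)"
      by (subst of_nat_mult, subst ln_mult) auto
    moreover have "n div d * d = n" using d by simp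
    ultimately show "mobius d * ln (real (n div d)) + mobius d * ln (real d) = mobius d * ln (real n)"
      by (simp add: distrib_left)
  qed
  also have "\<dots> = 0"
    using sum_mobius[OF assms] by (cases "n = 1") (simp_all flip: sum_distrib_right)
  finally show ?thesis using 1 by simp
qed

lemma sum_mobius_ln_divide:
  assumes n: "n > 0" and x: "x > 0"
  shows "(\<Sum>d | d dvd n. mobius d * ln (real x / real d)) = (if n = 1 then ln (real x) else 0) + mangoldt n"
proof -
  have "(\<Sum>d | d dvd n. mobius d * ln (real x / real d))
      = (\<Sum>d | d dvd n. mobius d * ln (real x) - mobius d * ln (real d))"
  proof (rule sum.cong[OF refl])
    fix d assume "d \<in> {d. d dvd n}"
    then have "d > 0" using n by (auto intro!: Nat.gr0I)
    then have "ln (real x / real d) = ln (real x) - ln (real d)" using x by (intro ln_divide_pos) auto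
    then show "mobius d * ln (real x / real d) = mobius d * ln (real x) - mobius d * ln (real d)"
      by (simp only: right_diff_distrib)
  qed
  also have "\<dots> = (\<Sum>d | d dvd n. mobius d) * ln (real x) - (\<Sum>d | d dvd n. mobius d * ln (real d))"
    by (simp only: sum_subtractf sum_distrib_right)
  finally show ?thesis using sum_mobius[OF n] sum_mobius_ln[OF n] by simp
qed

text \<open>A vanishing series makes \<open>f\<close> equal to \<open>-1\<close> on average over the primes. The identity behind this is \<open>\<Sum>\<^bsub>d | n\<^esub> \<mu>(d) ln (x / d) = [n = 1] ln x + \<Lambda>(n)\<close>, summed
  with the weights \<open>f n / n\<close>.\<close>

lemma mangoldt_sum_char_zero:
  assumes f: "f \<in> dchars N" and N: "N > 0" and L: "has_L N f 0" and x: "x > 0"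
  shows "norm (mangoldt_sum_char f x + complex_of_real (ln (real x))) \<le> 2 * real N"
proof -
  define w where "w d = mobius d * ln (real x / real d)" for d
  have "mangoldt_sum_char f x + complex_of_real (ln (real x))
      = (\<Sum>n=1..x. f n / of_nat n * complex_of_real (\<Sum>d | d dvd n. w d))"
  proof -
    have "(\<Sum>n=1..x. f n / of_nat n * complex_of_real (\<Sum>d | d dvd n. w d))
        = (\<Sum>n=1..x. (if n = 1 then complex_of_real (ln (real x)) else 0) + f n * mangoldt n / of_nat n)"
    proof (rule sum.cong[OF refl])
      fix n assume "n \<in> {1..x}"
      then have n: "n > 0" by auto
      show "f n / of_nat n * complex_of_real (\<Sum>d | d dvd n. w d)
          = (if n = 1 then complex_of_real (ln (real x)) else 0) + f n * mangoldt n / of_nat n"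
        unfolding w_def sum_mobius_ln_divide[OF n x] by (simp add: dchars_1[OF f])
    qed
    also have "\<dots> = (\<Sum>n=1..x. if n = 1 then complex_of_real (ln (real x)) else 0)
        + (\<Sum>n=1..x. f n * mangoldt n / of_nat n)"
      by (rule sum.distrib)
    also have "(\<Sum>n=1..x. if n = 1 then complex_of_real (ln (real x)) else 0) = complex_of_real (ln (real x))"
      using x by (subst sum.delta) auto
    finally show ?thesis by (simp add: mangoldt_sum_char_def)
  qed
  also have "\<dots> = (\<Sum>n=1..x. \<Sum>d | d dvd n.
      f d * complex_of_real (w d) / of_nat d * (f (n div d) / of_nat (n div d)))"
  proof (rule sum.cong[OF refl])
    fix n assume n: "n \<in> {1..x}"
    have "f n / of_nat n = f d * f (n div d) / (of_nat d * of_nat (n div d))" if "d dvd n" for d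
      using dchars_mult[OF f, of d "n div d"] of_nat_mult[of d "n div d", where 'a = complex] that
      by simp
    then show "f n / of_nat n * complex_of_real (\<Sum>d | d dvd n. w d) =
        (\<Sum>d | d dvd n. f d * complex_of_real (w d) / of_nat d * (f (n div d) / of_nat (n div d)))"
      unfolding of_real_sum sum_distrib_left by (intro sum.cong refl) simp
  qed
  also have "\<dots> = (\<Sum>d=1..x. f d * complex_of_real (w d) / of_nat d * partial_L f (x div d))"
    unfolding partial_L_def sum_distrib_left
    by (rule sum_divisors_swap[where g = "\<lambda>d m. f d * complex_of_real (w d) / of_nat d * (f m / of_nat m)"])
  also have "norm \<dots> \<le> (\<Sum>d=1..x. 2 * real N / real x * (ln (real x) - ln (real d)))"
  proof (rule sum_norm_le)
    fix d assume d: "d \<in> {1..x}"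
    have ln: "ln (real x / real d) = ln (real x) - ln (real d)" "ln (real x / real d) \<ge> 0"
      using d x by (auto simp: ln_div)
    have "norm (f d * complex_of_real (w d) / of_nat d * partial_L f (x div d))
        = (norm (f d) * \<bar>mobius d\<bar>) * (ln (real x / real d) / real d * norm (partial_L f (x div d)))"
      using ln(2) by (simp add: w_def norm_mult norm_divide abs_mult)
    also have "\<dots> \<le> (1 * 1) * (ln (real x / real d) / real d * (2 * real N * real d / real x))"
      using has_L_div[OF L, of d x] d ln(2) x
      by (intro mult_mono norm_dchars_le[OF f N] abs_mobius_le)
         (auto intro!: mult_nonneg_nonneg divide_nonneg_nonneg)
    also have "\<dots> = 2 * real N / real x * (ln (real x) - ln (real d))"
      using d unfolding ln(1) by simp
    finally show "norm (f d * complex_of_real (w d) / of_nat d * partial_L f (x div d))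
        \<le> 2 * real N / real x * (ln (real x) - ln (real d))" .
  qed
  also have "\<dots> = 2 * real N / real x * (\<Sum>d=1..x. ln (real x) - ln (real d))"
    by (rule sum_distrib_left [symmetric])
  also have "(\<Sum>d=1..x. ln (real x) - ln (real d)) = real x * ln (real x) - ln (fact x)"
    by (simp add: ln_fact_eq_sum sum_subtractf)
  also have "2 * real N / real x * (real x * ln (real x) - ln (fact x)) \<le> 2 * real N / real x * real x"
    using ln_fact_ge[of x] by (intro mult_left_mono) auto
  finally show ?thesis using x by simp
qed

section \<open>Real characters\<close>

lemma sum_powers_sign:
  fixes x :: real
  assumes "x = -1 \<or> x = 0 \<or> x = 1"
  shows "(\<Sum>i\<le>k. x ^ i) \<ge> 0" "even k \<Longrightarrow> (\<Sum>i\<le>k. x ^ i) \<ge> 1"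
proof -
  have 1: "(\<Sum>i\<le>k. (- 1 :: real) ^ i) = (if even k then 1 else 0)" by (induction k) auto
  have 0: "(\<Sum>i\<le>k. (0 :: real) ^ i) = 1" by (induction k) auto
  show "(\<Sum>i\<le>k. x ^ i) \<ge> 0" "even k \<Longrightarrow> (\<Sum>i\<le>k. x ^ i) \<ge> 1"
    using assms 0 1 by auto
qed

text \<open>The divisor sum is multiplicative, and on a prime power it is a geometric sum with ratio \<open>-1\<close>, \<open>0\<close> or
  \<open>1\<close>; for an even exponent such a sum is positive.\<close>

lemma sum_divisors_completely_multiplicative:
  fixes r :: "nat \<Rightarrow> real"
  assumes r1: "r 1 = 1" and mult: "\<And>m n. r (m * n) = r m * r n"
    and sign: "\<And>n. r n = -1 \<or> r n = 0 \<or> r n = 1" and n: "n > 0"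
  shows "(\<Sum>d | d dvd n. r d) \<ge> 0 \<and> (\<Sum>d | d dvd n\<^sup>2. r d) \<ge> 1"
  using n
proof (induction n rule: less_induct)
  case (less n)
  show ?case
  proof (cases "n = 1")
    case True
    then show ?thesis using r1 by simp
  next
    case False
    then have "n > 1" using less.prems by simp
    then obtain p k m where p: "prime p" "k > 0" "\<not> p dvd m" "n = p ^ k * m" "0 < m" "m < n"
      by (rule prime_power_split)
    have pow: "r (p ^ i) = r p ^ i" for i by (induction i) (use r1 mult in auto)
    have eq: "(\<Sum>d | d dvd p ^ j * l. r d) = (\<Sum>i\<le>j. r p ^ i) * (\<Sum>d | d dvd l. r d)"
      if "\<not> p dvd l" "l > 0" for j l
      unfolding sum_divisors_prime_power_mult[OF p(1) that] by (simp add: mult pow sum_product)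
    have n2: "n\<^sup>2 = p ^ (2 * k) * m\<^sup>2" by (simp add: p(4) power_mult_distrib power_mult mult.commute)
    have pm2: "\<not> p dvd m\<^sup>2" using p(1,3) by (auto dest: prime_dvd_power)
    have IH: "(\<Sum>d | d dvd m. r d) \<ge> 0" "(\<Sum>d | d dvd m\<^sup>2. r d) \<ge> 1"
      using less.IH[OF p(6,5)] by auto
    have "(\<Sum>d | d dvd n. r d) \<ge> 0"
      unfolding p(4) eq[OF p(3,5)] by (intro mult_nonneg_nonneg IH sum_powers_sign sign)
    moreover have "1 * 1 \<le> (\<Sum>i\<le>2 * k. r p ^ i) * (\<Sum>d | d dvd m\<^sup>2. r d)"
      by (intro mult_mono IH sum_powers_sign sign) auto
    then have "(\<Sum>d | d dvd n\<^sup>2. r d) \<ge> 1"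
      unfolding n2 by (subst eq[OF pm2]) (use p(5) in auto)
    ultimately show ?thesis by blast
  qed
qed

text \<open>The inequality of the arithmetic and geometric means for the powers of \<open>v\<^sup>2\<close>, proved by pairing the first term
  with the last.\<close>

lemma geometric_even_powers_ge:
  fixes v :: real
  assumes v: "0 < v" "v < 1"
  shows "real n * v ^ (n - 1) \<le> (\<Sum>i<n. (v\<^sup>2) ^ i)"
proof (induction n rule: nat_less_induct)
  case (1 n)
  show ?case
  proof (cases "n \<ge> 2")
    case False
    then have "n = 0 \<or> n = 1" by auto
    then show ?thesis by auto
  next
    case True
    then obtain m where m: "n = Suc (Suc m)" by (metis add_2_eq_Suc le_Suc_ex)
    have IH: "real m * v ^ (m - 1) \<le> (\<Sum>i<m. (v\<^sup>2) ^ i)" using 1 m by simp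
    have "real m * v ^ Suc m = v\<^sup>2 * (real m * v ^ (m - 1))"
      by (cases m) (simp_all add: power2_eq_square algebra_simps)
    also have "\<dots> \<le> v\<^sup>2 * (\<Sum>i<m. (v\<^sup>2) ^ i)" using IH by (intro mult_left_mono) auto
    finally have a: "real m * v ^ Suc m \<le> v\<^sup>2 * (\<Sum>i<m. (v\<^sup>2) ^ i)" .
    have "0 \<le> (1 - v ^ Suc m)\<^sup>2" by simp
    then have b: "2 * v ^ Suc m \<le> 1 + (v\<^sup>2) ^ Suc m"
      by (simp add: power2_eq_square algebra_simps power_mult_distrib)
    have "(\<Sum>i<n. (v\<^sup>2) ^ i) = (\<Sum>i<Suc m. (v\<^sup>2) ^ i) + (v\<^sup>2) ^ Suc m" by (simp add: m)
    also have "(\<Sum>i<Suc m. (v\<^sup>2) ^ i) = 1 + v\<^sup>2 * (\<Sum>i<m. (v\<^sup>2) ^ i)"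
      by (subst sum.lessThan_Suc_shift) (simp add: sum_distrib_left)
    finally show ?thesis using a b by (simp add: m algebra_simps)
  qed
qed

context
  fixes t :: real
  assumes t: "0 < t" "t < 1"
begin

definition geometric :: "nat \<Rightarrow> real" where
  "geometric n = (\<Sum>i<n. t ^ i)"

text \<open>The difference between \<open>1 / (n (1 - t))\<close> and the Lambert term \<open>t ^ n / (1 - t ^ n)\<close>, written with the
  geometric sum. It decreases in \<open>n\<close> and starts at \<open>1\<close> for every \<open>t\<close>; this uniformity in \<open>t\<close> is what
  the comparison rests on (an idea of Monsky).\<close>

definition lambert_gap :: "nat \<Rightarrow> real" where
  "lambert_gap n = (1 / real n - t ^ n / geometric n) / (1 - t)"

lemma geometric_eq: "(1 - t) * geometric n = 1 - t ^ n"
  using t unfolding geometric_def by (simp add: sum_gp_strict field_simps)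

lemma geometric_pos: "n > 0 \<Longrightarrow> geometric n > 0"
  unfolding geometric_def using t by (intro sum_pos) auto

lemma geometric_ge: "real n * sqrt t ^ (n - 1) \<le> geometric n"
  using geometric_even_powers_ge[of "sqrt t" n] t by (simp add: geometric_def)

lemma sqrt_t: "0 < sqrt t" "sqrt t < 1"
  using t by (auto simp: real_sqrt_lt_1_iff)

lemma lambert_gap_1: "lambert_gap 1 = 1"
  using t by (simp add: lambert_gap_def geometric_def)

lemma lambert_gap_nonneg:
  assumes "n \<ge> 1"
  shows "lambert_gap n \<ge> 0"
proof -
  have "t ^ n = (sqrt t) ^ (2 * n)" using t by (simp add: power_mult)
  also have "\<dots> \<le> sqrt t ^ (n - 1)" using sqrt_t by (intro power_decreasing) auto
  finally have "real n * t ^ n \<le> geometric n" using geometric_ge[of n] by (meson mult_left_mono of_nat_0_le_iff order_trans)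
  then have "t ^ n / geometric n \<le> 1 / real n" using geometric_pos[of n] assms by (simp add: field_simps)
  then show ?thesis using t by (simp add: lambert_gap_def)
qed

lemma lambert_gap_decreasing:
  assumes "n \<ge> 1"
  shows "lambert_gap (Suc n) \<le> lambert_gap n"
proof -
  have pos: "geometric n > 0" "geometric (Suc n) > 0" using assms by (auto intro: geometric_pos)
  have "t ^ n = sqrt t ^ (2 * n)" using t by (simp add: power_mult)
  also have "\<dots> \<le> sqrt t ^ ((n - 1) + n)" using sqrt_t by (intro power_decreasing) auto
  finally have "real n * real (Suc n) * t ^ n \<le> real n * real (Suc n) * sqrt t ^ ((n - 1) + n)"
    by (intro mult_left_mono) auto
  also have "\<dots> = (real n * sqrt t ^ (n - 1)) * (real (Suc n) * sqrt t ^ (Suc n - 1))"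
    by (simp add: power_add)
  also have "\<dots> \<le> geometric n * geometric (Suc n)"
    using geometric_ge[of n] geometric_ge[of "Suc n"] pos sqrt_t by (intro mult_mono) auto
  finally have "real n * real (Suc n) * t ^ n \<le> geometric n * geometric (Suc n)" .
  moreover have "y / b \<le> 1 / a" if "a * y \<le> b" "a > 0" "b > 0" for a b y :: real
    using that by (simp add: field_simps)
  ultimately have le: "t ^ n / (geometric n * geometric (Suc n)) \<le> 1 / (real n * real (Suc n))"
    using pos assms by (simp del: of_nat_Suc)
  have "geometric (Suc n) - t * geometric n = 1"
    unfolding geometric_def by (subst sum.lessThan_Suc_shift) (simp add: sum_distrib_left)
  then have "t ^ n / geometric n - t ^ Suc n / geometric (Suc n) = t ^ n / (geometric n * geometric (Suc n))"
    using pos by (simp add: field_simps)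
  moreover have "1 / real n - 1 / real (Suc n) = 1 / (real n * real (Suc n))"
    using assms by (simp add: field_simps)
  ultimately have "1 / real (Suc n) - t ^ Suc n / geometric (Suc n) \<le> 1 / real n - t ^ n / geometric n"
    using le by linarith
  then show ?thesis unfolding lambert_gap_def using t by (intro divide_right_mono) auto
qed

lemma sum_multiples_eq:
  assumes "n \<ge> 1"
  shows "(\<Sum>j=1..J. t ^ (n * j)) = 1 / (real n * (1 - t)) - lambert_gap n - t ^ (n * Suc J) / (1 - t ^ n)"
proof -
  have g: "(1 - t) * geometric n = 1 - t ^ n" by (rule geometric_eq)
  have pos: "geometric n > 0" "1 - t > 0" using assms geometric_pos t by auto
  have tn: "1 - t ^ n > 0" using pos g by (metis mult_pos_pos)
  have m: "1 / (real n * (1 - t)) - lambert_gap n = t ^ n / (1 - t ^ n)"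
    unfolding lambert_gap_def g[symmetric] by (simp add: diff_divide_distrib mult.commute)
  have "(1 - t ^ n) * (\<Sum>j=1..J. t ^ (n * j)) = t ^ n - t ^ (n * Suc J)"
  proof (induction J)
    case (Suc J)
    have "(1 - t ^ n) * (\<Sum>j=1..Suc J. t ^ (n * j)) = (1 - t ^ n) * (\<Sum>j=1..J. t ^ (n * j)) + (1 - t ^ n) * t ^ (n * Suc J)"
      by (simp add: distrib_left)
    also have "\<dots> = t ^ n - t ^ (n * Suc J) + (1 - t ^ n) * t ^ (n * Suc J)" by (simp only: Suc)
    also have "\<dots> = t ^ n - t ^ (n * Suc (Suc J))" by (simp add: algebra_simps power_add)
    finally show ?case .
  qed simp
  then have "(\<Sum>j=1..J. t ^ (n * j)) = (t ^ n - t ^ (n * Suc J)) / (1 - t ^ n)"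
    using tn by (simp add: field_simps)
  then show ?thesis unfolding m by (simp add: diff_divide_distrib)
qed

end

lemma real_char_values:
  assumes f: "f \<in> dchars N" and N: "N > 0" and real: "\<And>n. cnj (f n) = f n"
  shows "f n = of_real (Re (f n))" "Re (f n) = -1 \<or> Re (f n) = 0 \<or> Re (f n) = 1"
proof -
  have "Im (f n) = 0" using real[of n] by (simp add: complex_eq_iff)
  then show eq: "f n = of_real (Re (f n))" by (simp add: complex_eq_iff)
  have "norm (f n) = 1 \<or> f n = 0"
    using norm_dchars[OF f _ N, of n] dchars_eq_0_iff[OF f, of n] by blast
  moreover have "norm (f n) = \<bar>Re (f n)\<bar>" by (subst eq) (simp only: norm_of_real)
  ultimately show "Re (f n) = -1 \<or> Re (f n) = 0 \<or> Re (f n) = 1" by auto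
qed

lemma sum_squares_le_sum:
  fixes g :: "nat \<Rightarrow> real"
  assumes "\<And>n. n > 0 \<Longrightarrow> g n \<ge> 0" "\<And>j. j > 0 \<Longrightarrow> h j \<le> g (j\<^sup>2)" "K\<^sup>2 \<le> X"
  shows "(\<Sum>j=1..K. h j) \<le> (\<Sum>n=1..X. g n)"
proof -
  have "(\<Sum>j=1..K. h j) \<le> (\<Sum>j=1..K. g (j\<^sup>2))" using assms(2) by (intro sum_mono) auto
  also have "\<dots> = (\<Sum>n\<in>(\<lambda>j. j\<^sup>2) ` {1..K}. g n)"
    by (subst sum.reindex) (auto simp: inj_on_def)
  also have "\<dots> \<le> (\<Sum>n=1..X. g n)"
  proof (intro sum_mono2)
    show "(\<lambda>j. j\<^sup>2) ` {1..K} \<subseteq> {1..X}"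
    proof
      fix n assume "n \<in> (\<lambda>j. j\<^sup>2) ` {1..K}"
      then obtain j where j: "n = j\<^sup>2" "1 \<le> j" "j \<le> K" by auto
      have "j\<^sup>2 \<le> K\<^sup>2" using j by (intro power_mono) auto
      then have "j\<^sup>2 \<le> X" using assms(3) by (rule order_trans)
      then show "n \<in> {1..X}" using j by (simp add: Suc_le_eq)
    qed
  qed (use assms(1) in auto)
  finally show ?thesis .
qed

text \<open>The Lambert series of \<open>f\<close> has the divisor sums of \<open>f\<close> as coefficients, which are nonnegative and at least \<open>1\<close>
  at squares. Truncated at \<open>X\<close>, it differs from a multiple of the partial sum of \<open>f(n)/n\<close> by a sum that
  partial summation bounds by \<open>2 N\<close>, and by a truncation error that vanishes for large \<open>X\<close>.\<close>

lemma square_powers_bound: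
  assumes f: "f \<in> dchars N" "f \<noteq> principal_char N" and N: "N > 0" and real: "\<And>n. cnj (f n) = f n"
    and L: "has_L N f 0" and t: "0 < t" "t < (1::real)" and X: "K\<^sup>2 \<le> X"
  shows "(\<Sum>j=1..K. t ^ j\<^sup>2) \<le> 2 * real N + (2 * real N / real (X + 1) + real X * t ^ X) / (1 - t)"
proof -
  define r where "r n = Re (f n)" for n
  have fr: "f n = of_real (r n)" for n unfolding r_def using real_char_values(1)[OF f(1) N real] .
  have sign: "r n = -1 \<or> r n = 0 \<or> r n = 1" for n
    unfolding r_def using real_char_values(2)[OF f(1) N real] .
  have mult: "r (m * n) = r m * r n" for m n
    using dchars_mult[OF f(1), of m n] unfolding fr by (simp flip: of_real_mult)
  have r1: "r 1 = 1" using dchars_1[OF f(1)] by (simp add: r_def)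
  note F = sum_divisors_completely_multiplicative[of r, OF r1 mult sign]
  define b where "b = lambert_gap t"
  have "(\<Sum>j=1..K. t ^ j\<^sup>2) \<le> (\<Sum>n=1..X. (\<Sum>d | d dvd n. r d) * t ^ n)"
  proof (rule sum_squares_le_sum[OF _ _ X])
    show "0 \<le> (\<Sum>d | d dvd n. r d) * t ^ n" if "n > 0" for n
      using F[OF that] t by (intro mult_nonneg_nonneg) auto
    show "t ^ j\<^sup>2 \<le> (\<Sum>d | d dvd j\<^sup>2. r d) * t ^ j\<^sup>2" if "j > 0" for j
      using F[OF that] t mult_right_mono[of 1 "\<Sum>d | d dvd j\<^sup>2. r d" "t ^ j\<^sup>2"] by simp
  qed
  also have "\<dots> = (\<Sum>n=1..X. \<Sum>d | d dvd n. r d * t ^ (d * (n div d)))"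
    by (intro sum.cong refl) (simp add: sum_distrib_right)
  also have "\<dots> = (\<Sum>d=1..X. \<Sum>j=1..X div d. r d * t ^ (d * j))"
    by (rule sum_divisors_swap[where g = "\<lambda>d j. r d * t ^ (d * j)"])
  also have "\<dots> = (\<Sum>d=1..X. r d * (1 / (real d * (1 - t)) - b d - t ^ (d * Suc (X div d)) / (1 - t ^ d)))"
  proof (rule sum.cong[OF refl])
    fix d assume "d \<in> {1..X}"
    then have "(\<Sum>j=1..X div d. t ^ (d * j))
        = 1 / (real d * (1 - t)) - b d - t ^ (d * Suc (X div d)) / (1 - t ^ d)"
      unfolding b_def by (intro sum_multiples_eq[OF t]) simp
    then show "(\<Sum>j=1..X div d. r d * t ^ (d * j))
        = r d * (1 / (real d * (1 - t)) - b d - t ^ (d * Suc (X div d)) / (1 - t ^ d))"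
      by (simp only: sum_distrib_left [symmetric])
  qed
  also have "\<dots> = (\<Sum>d=1..X. r d / real d) / (1 - t) - (\<Sum>d=1..X. r d * b d)
      - (\<Sum>d=1..X. r d * (t ^ (d * Suc (X div d)) / (1 - t ^ d)))"
    by (simp add: right_diff_distrib sum_subtractf sum_divide_distrib)
  also have "\<dots> \<le> (2 * real N / real (X + 1)) / (1 - t) + 2 * real N + real X * (t ^ X / (1 - t))"
  proof -
    have "of_real (\<Sum>d=1..X. r d / real d) = partial_L f X"
      by (simp add: partial_L_def fr)
    then have "\<bar>\<Sum>d=1..X. r d / real d\<bar> \<le> 2 * real N / real (X + 1)"
      using L unfolding has_L_def by (metis norm_of_real diff_zero)
    then have 1: "(\<Sum>d=1..X. r d / real d) / (1 - t) \<le> (2 * real N / real (X + 1)) / (1 - t)"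
      using t by (intro divide_right_mono) auto
    have "norm (\<Sum>d=1..<Suc X. f d * of_real (b d)) \<le> 2 * real N * b 1"
      unfolding b_def
      by (rule sum_by_parts_bound[OF norm_sum_dchars_le[OF f N]])
         (use lambert_gap_decreasing[OF t] lambert_gap_nonneg[OF t] in auto)
    moreover have "(\<Sum>d=1..<Suc X. f d * of_real (b d)) = of_real (\<Sum>d=1..X. r d * b d)"
      by (simp add: fr atLeastLessThanSuc_atLeastAtMost)
    ultimately have "\<bar>\<Sum>d=1..X. r d * b d\<bar> \<le> 2 * real N * b 1" by (metis norm_of_real)
    then have 2: "- (\<Sum>d=1..X. r d * b d) \<le> 2 * real N" using lambert_gap_1[OF t] by (simp add: b_def)
    have "- (\<Sum>d=1..X. r d * (t ^ (d * Suc (X div d)) / (1 - t ^ d))) \<le> (\<Sum>d=1..X. t ^ X / (1 - t))"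
      unfolding sum_negf [symmetric]
    proof (rule sum_mono)
      fix d assume d: "d \<in> {1..X}"
      have "X \<le> d * Suc (X div d)" using dividend_less_times_div[of d X] d by simp
      then have a: "t ^ (d * Suc (X div d)) \<le> t ^ X" using t by (intro power_decreasing) auto
      have "t ^ d \<le> t ^ 1" using d t by (intro power_decreasing) auto
      then have b: "1 - t \<le> 1 - t ^ d" by simp
      have c: "0 \<le> t ^ (d * Suc (X div d)) / (1 - t ^ d)" using b t by (intro divide_nonneg_nonneg) auto
      have "- (r d * (t ^ (d * Suc (X div d)) / (1 - t ^ d))) \<le> t ^ (d * Suc (X div d)) / (1 - t ^ d)"
        using sign[of d] c by auto
      also have "\<dots> \<le> t ^ X / (1 - t)" using a b t by (intro frac_le) auto
      finally show "- (r d * (t ^ (d * Suc (X div d)) / (1 - t ^ d))) \<le> t ^ X / (1 - t)" .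
    qed
    then have 3: "- (\<Sum>d=1..X. r d * (t ^ (d * Suc (X div d)) / (1 - t ^ d))) \<le> real X * (t ^ X / (1 - t))"
      by simp
    show ?thesis using 1 2 3 by linarith
  qed
  also have "\<dots> = 2 * real N + (2 * real N / real (X + 1) + real X * t ^ X) / (1 - t)"
    by (simp add: add_divide_distrib)
  finally show ?thesis .
qed

text \<open>If the series vanished, then the sum of \<open>t ^ j\<^sup>2\<close> over \<open>j \<le> K\<close> would be at most \<open>2 N\<close> for all \<open>t < 1\<close>;
  letting \<open>t\<close> tend to 1 gives \<open>K \<le> 2 N\<close> for every \<open>K\<close>.\<close>

lemma real_char_nonvanishing:
  assumes f: "f \<in> dchars N" "f \<noteq> principal_char N" and N: "N > 0" and real: "\<And>n. cnj (f n) = f n"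
  shows "\<not> has_L N f 0"
proof
  assume L: "has_L N f 0"
  define K where "K = 2 * N + 1"
  have le: "(\<Sum>j=1..K. t ^ j\<^sup>2) \<le> 2 * real N" if t: "0 < t" "t < 1" for t :: real
  proof -
    have "(\<lambda>X. 1 / real (Suc X)) \<longlonglongrightarrow> 0"
      using LIMSEQ_inverse_real_of_nat by (simp add: inverse_eq_divide)
    from tendsto_mult_left[OF this, of "2 * real N"]
    have 1: "(\<lambda>X. 2 * real N * (1 / real (Suc X))) \<longlonglongrightarrow> 2 * real N * 0" .
    have 2: "(\<lambda>X. real X * t ^ X) \<longlonglongrightarrow> 0"
      using powser_times_n_limit_0[of t] t by simp
    have "(\<lambda>X. 2 * real N + (2 * real N * (1 / real (Suc X)) + real X * t ^ X) / (1 - t))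
        \<longlonglongrightarrow> 2 * real N + (2 * real N * 0 + 0) / (1 - t)"
      by (rule tendsto_add[OF tendsto_const tendsto_divide[OF tendsto_add[OF 1 2] tendsto_const]])
         (use t in auto)
    then have lim: "(\<lambda>X. 2 * real N + (2 * real N / real (X + 1) + real X * t ^ X) / (1 - t)) \<longlonglongrightarrow> 2 * real N"
      by simp
    show ?thesis
      by (rule tendsto_lowerbound[OF lim])
         (use square_powers_bound[OF f N real L t, of K] in \<open>auto simp: eventually_sequentially\<close>)
  qed
  have "(\<lambda>n. 1 - inverse (real (Suc (Suc n)))) \<longlonglongrightarrow> 1 - 0"
    by (intro tendsto_intros LIMSEQ_Suc[OF LIMSEQ_inverse_real_of_nat])
  then have lim: "(\<lambda>n. \<Sum>j=1..K. (1 - inverse (real (Suc (Suc n)))) ^ j\<^sup>2) \<longlonglongrightarrow> (\<Sum>j=1..K. (1 - 0) ^ j\<^sup>2)"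
    by (intro tendsto_sum tendsto_power)
  have "(\<Sum>j=1..K. (1 - inverse (real (Suc (Suc n)))) ^ j\<^sup>2) \<le> 2 * real N" for n
    by (rule le) (auto simp: field_simps)
  then have "(\<Sum>j=1..K. (1 - 0 :: real) ^ j\<^sup>2) \<le> 2 * real N"
    by (intro LIMSEQ_le_const2[OF lim]) blast
  then show False by (simp add: K_def)
qed

section \<open>Primes in arithmetic progressions\<close>

text \<open>If the series of \<open>f\<close> vanishes, so does that of the conjugate character, which differs from \<open>f\<close> because \<open>f\<close>
  is not real. Then the nonnegative sum over all characters is at most \<open>- ln x + O(1)\<close>.\<close>

lemma char_nonvanishing:
  assumes f: "f \<in> dchars N" "f \<noteq> principal_char N" and N: "N > 0"
  shows "\<not> has_L N f 0"
proof
  assume L: "has_L N f 0"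
  define g where "g n = cnj (f n)" for n
  have g: "g \<in> dchars N" unfolding g_def by (rule dchars_cnj[OF f(1)])
  have "g \<noteq> f" using real_char_nonvanishing[OF f N] L unfolding g_def by metis
  have Lg: "has_L N g 0"
    unfolding has_L_def
  proof
    fix k
    have "partial_L g k = cnj (partial_L f k)" by (simp add: partial_L_def g_def)
    then show "norm (partial_L g k - 0) \<le> 2 * real N / real (k + 1)"
      using L unfolding has_L_def by simp
  qed
  have gp: "g \<noteq> principal_char N"
  proof
    assume "g = principal_char N"
    then have "f n = principal_char N n" for n
      unfolding g_def fun_eq_iff principal_char_def by (metis complex_cnj_cnj complex_cnj_one complex_cnj_zero)
    then show False using f(2) by blast
  qed
  have upper: "\<exists>C. \<forall>x>0. Re (mangoldt_sum_char h x) \<le> C" if h: "h \<in> dchars N" "h \<noteq> principal_char N" for h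
  proof -
    obtain M where M: "has_L N h M" using has_L_exists[OF h N] .
    show ?thesis
    proof (cases "M = 0")
      case False
      obtain C where "\<And>x. norm (mangoldt_sum_char h x) \<le> C"
        using mangoldt_sum_char_bounded[OF h N M False] by blast
      then show ?thesis using complex_Re_le_cmod order_trans by blast
    next
      case True
      have "Re (mangoldt_sum_char h x) \<le> 2 * real N" if "x > 0" for x
      proof -
        have "Re (mangoldt_sum_char h x + complex_of_real (ln (real x))) \<le> 2 * real N"
          using mangoldt_sum_char_zero[OF h(1) N _ that] M True complex_Re_le_cmod order_trans by blast
        moreover have "ln (real x) \<ge> 0" using that by simp
        ultimately show ?thesis by simp
      qed
      then show ?thesis by blast
    qed
  qed
  then obtain C where C: "\<And>h x. h \<in> dchars N \<Longrightarrow> h \<noteq> principal_char N \<Longrightarrow> x > 0 \<Longrightarrow> Re (mangoldt_sum_char h x) \<le> C h"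
    by metis
  define D where "D = dchars N - {principal_char N, f, g}"
  have fin: "finite (dchars N)" using finite_dchars[OF N] .
  have bound: "ln (real x) \<le> 4 + 4 * real N + (\<Sum>h\<in>D. C h)" if x: "x > 0" for x
  proof -
    have "Re (\<Sum>h\<in>dchars N. mangoldt_sum_char h x) \<ge> 0"
    proof -
      have "(\<Sum>h\<in>dchars N. mangoldt_sum_char h x) = (\<Sum>d=1..x. (\<Sum>h\<in>dchars N. h d) * mangoldt d / of_nat d)"
        unfolding mangoldt_sum_char_def
        by (subst sum.swap) (simp add: sum_distrib_right sum_divide_distrib)
      also have "Re \<dots> \<ge> 0"
        unfolding Re_sum
      proof (rule sum_nonneg)
        fix d assume "d \<in> {1..x}"
        have "(\<Sum>h\<in>dchars N. h d) = (if [d = 1] (mod N) then of_nat (card (dchars N)) else 0)"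
          using sum_dchars_cnj[OF N, of 1 d] by (simp add: dchars_1 cong: sum.cong)
        then have "(\<Sum>h\<in>dchars N. h d) * mangoldt d / of_nat d
            = of_real ((if [d = 1] (mod N) then real (card (dchars N)) else 0) * mangoldt d / real d)"
          by simp
        then show "Re ((\<Sum>h\<in>dchars N. h d) * mangoldt d / of_nat d) \<ge> 0"
          by (simp only: Re_complex_of_real) (auto intro!: divide_nonneg_nonneg mult_nonneg_nonneg mangoldt_nonneg)
      qed
      finally show ?thesis .
    qed
    also have "(\<Sum>h\<in>dchars N. mangoldt_sum_char h x) = (\<Sum>h\<in>{principal_char N, f, g} \<union> D. mangoldt_sum_char h x)"
      by (rule sum.cong) (use f(1) g principal_char_in_dchars[OF N] in \<open>auto simp: D_def\<close>)
    also have "\<dots> = (\<Sum>h\<in>{principal_char N, f, g}. mangoldt_sum_char h x) + (\<Sum>h\<in>D. mangoldt_sum_char h x)"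
      using fin by (intro sum.union_disjoint) (auto simp: D_def)
    also have "(\<Sum>h\<in>{principal_char N, f, g}. mangoldt_sum_char h x)
        = mangoldt_sum_char (principal_char N) x + mangoldt_sum_char f x + mangoldt_sum_char g x"
      using f(2) gp \<open>g \<noteq> f\<close> by auto
    also have "Re (\<dots> + (\<Sum>h\<in>D. mangoldt_sum_char h x)) = Re (mangoldt_sum_char (principal_char N) x)
        + Re (mangoldt_sum_char f x) + Re (mangoldt_sum_char g x) + (\<Sum>h\<in>D. Re (mangoldt_sum_char h x))"
      by simp
    also have "\<dots> \<le> (ln (real x) + 4) + (2 * real N - ln (real x)) + (2 * real N - ln (real x)) + (\<Sum>h\<in>D. C h)"
    proof (intro add_mono sum_mono)
      have "Re (mangoldt_sum_char (principal_char N) x) \<le> (\<Sum>d=1..x. mangoldt d / real d)"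
        unfolding mangoldt_sum_char_def Re_sum
        by (intro sum_mono) (auto simp: principal_char_def intro!: divide_nonneg_nonneg mangoldt_nonneg)
      then show "Re (mangoldt_sum_char (principal_char N) x) \<le> ln (real x) + 4"
        using mertens_le[OF x] by simp
      have "Re (mangoldt_sum_char h x + complex_of_real (ln (real x))) \<le> 2 * real N"
        if "h \<in> dchars N" "has_L N h 0" for h
        using mangoldt_sum_char_zero[OF that(1) N that(2) x] complex_Re_le_cmod order_trans by blast
      from this[OF f(1) L] this[OF g Lg]
      show "Re (mangoldt_sum_char f x) \<le> 2 * real N - ln (real x)"
        "Re (mangoldt_sum_char g x) \<le> 2 * real N - ln (real x)" by simp_all
      show "Re (mangoldt_sum_char h x) \<le> C h" if "h \<in> D" for h
        using that C x by (auto simp: D_def)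
    qed
    finally show ?thesis by simp
  qed
  define B where "B = 4 + 4 * real N + (\<Sum>h\<in>D. C h)"
  obtain x :: nat where x: "exp (B + 1) < real x" using reals_Archimedean2 by blast
  then have "x > 0" by (metis exp_gt_zero less_trans of_nat_0_less_iff)
  then have "ln (exp (B + 1)) < ln (real x)" using x by (subst ln_less_cancel_iff) auto
  then have "B + 1 < ln (real x)" by simp
  then show False using bound[OF \<open>x > 0\<close>] by (simp add: B_def)
qed

lemma sum_Un_le:
  fixes g :: "'a \<Rightarrow> real"
  assumes "finite A" "finite B" "\<And>x. g x \<ge> 0"
  shows "sum g (A \<union> B) \<le> sum g A + sum g B"
  using sum.union_inter[OF assms(1,2), of g] sum_nonneg[of "A \<inter> B" g] assms(3) by simp

lemma sum_geometric_tail_le: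
  assumes "p \<ge> (2 :: nat)"
  shows "(\<Sum>k=2..x. 1 / real p ^ k) \<le> 2 / real p ^ 2"
proof -
  have split: "2 / real p ^ 2 = 1 / real p ^ 2 + 1 / real p ^ 2" "0 \<le> 1 / real p ^ 2"
    by simp_all
  have "(\<Sum>k=2..x. 1 / real p ^ k) \<le> 2 / real p ^ 2 - 1 / real p ^ max 2 x"
  proof (induction x)
    case 0
    show ?case using split by simp
  next
    case (Suc x)
    show ?case
    proof (cases "x \<ge> 2")
      case False
      then consider "x = 0" | "x = 1" by linarith
      then show ?thesis
      proof cases
        case 1
        then have eq: "{2..Suc x} = {}" "max 2 (Suc x) = 2" by auto
        show ?thesis unfolding eq using split by simp
      next
        case 2
        then have eq: "{2..Suc x} = {2}" "max 2 (Suc x) = 2" by auto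
        show ?thesis unfolding eq using split by simp
      qed
    next
      case True
      have "2 / real p ^ Suc x \<le> real p / real p ^ Suc x" using assms by (intro divide_right_mono) auto
      also have "\<dots> = 1 / real p ^ x" using assms by simp
      finally have "2 / real p ^ Suc x \<le> 1 / real p ^ x" .
      then show ?thesis using Suc True by (simp add: max_def)
    qed
  qed
  also have "\<dots> \<le> 2 / real p ^ 2" by simp
  finally show ?thesis .
qed

lemma ln_div_square_le: "ln (real p) / real p ^ 2 \<le> 2 * real p powr (- 3 / 2)"
proof (cases "p = 0")
  case False
  then have "ln (real p) \<le> 2 * real p powr (1 / 2)"
    using ln_powr_bound[of "real p" "1 / 2"] by simp
  then have "ln (real p) / real p ^ 2 \<le> 2 * real p powr (1 / 2) / real p ^ 2"
    by (intro divide_right_mono) auto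
  also have "\<dots> = 2 * (real p powr (1 / 2) / real p powr 2)" using False by simp
  also have "real p powr (1 / 2) / real p powr 2 = real p powr (1 / 2 - 2)"
    by (rule powr_diff [symmetric])
  finally show ?thesis by simp
qed simp

text \<open>Proper prime powers contribute at most the convergent sum of \<open>2 ln p / p\<^sup>2\<close>.\<close>

lemma mangoldt_nonprime_bounded:
  "\<exists>C. \<forall>x. (\<Sum>d | d \<in> {1..x} \<and> \<not> prime d. mangoldt d / real d) \<le> C"
proof -
  have summ: "summable (\<lambda>n. 4 * real n powr (- 3 / 2))"
    by (intro summable_mult) (simp add: summable_real_powr_iff)
  have "(\<Sum>d | d \<in> {1..x} \<and> \<not> prime d. mangoldt d / real d) \<le> (\<Sum>n. 4 * real n powr (- 3 / 2))" for x
  proof -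
    define A where "A = {2..x} \<times> {2..x}"
    have "(\<Sum>d | d \<in> {1..x} \<and> \<not> prime d. mangoldt d / real d)
        = (\<Sum>d | d \<in> {1..x} \<and> \<not> prime d \<and> primepow d. mangoldt d / real d)"
      by (rule sum.mono_neutral_right) (auto simp: mangoldt_def)
    also have "\<dots> \<le> (\<Sum>d\<in>(\<lambda>(p, k). p ^ k) ` {(p, k) \<in> A. prime p}. mangoldt d / real d)"
    proof (rule sum_mono2)
      show "{d. d \<in> {1..x} \<and> \<not> prime d \<and> primepow d} \<subseteq> (\<lambda>(p, k). p ^ k) ` {(p, k) \<in> A. prime p}"
      proof
        fix d assume "d \<in> {d. d \<in> {1..x} \<and> \<not> prime d \<and> primepow d}"
        then obtain p k where d: "prime p" "k > 0" "d = p ^ k" "\<not> prime d" "d \<le> x"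
          unfolding primepow_def by auto
        have "k \<noteq> 1" using d by auto
        then have "k \<ge> 2" using d(2) by simp
        have p2: "p \<ge> 2" using prime_ge_2_nat[OF d(1)] .
        have "p ^ 1 \<le> p ^ k" using d(2) p2 by (intro power_increasing) auto
        moreover have "k < p ^ k" using p2 by (intro less_le_trans[OF less_exp power_mono]) auto
        ultimately have "(p, k) \<in> {(p, k) \<in> A. prime p}"
          using \<open>k \<ge> 2\<close> p2 d by (auto simp: A_def)
        then show "d \<in> (\<lambda>(p, k). p ^ k) ` {(p, k) \<in> A. prime p}"
          using d(3) by (intro image_eqI[of _ _ "(p, k)"]) auto
      qed
    next
      have "finite {(p, k) \<in> A. prime p}" by (rule finite_subset[of _ A]) (auto simp: A_def)
      then show "finite ((\<lambda>(p, k). p ^ k) ` {(p, k) \<in> A. prime p})" by (rule finite_imageI)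
    qed (auto intro!: divide_nonneg_nonneg mangoldt_nonneg)
    also have "\<dots> \<le> sum ((\<lambda>d. mangoldt d / real d) \<circ> (\<lambda>(p, k). p ^ k)) {(p, k) \<in> A. prime p}"
    proof (rule sum_image_le)
      show "finite {(p, k) \<in> A. prime p}" by (rule finite_subset[of _ A]) (auto simp: A_def)
    qed (auto intro!: divide_nonneg_nonneg mangoldt_nonneg)
    also have "\<dots> = (\<Sum>y\<in>{(p, k) \<in> A. prime p}. (\<lambda>(p, k). ln (real p) * (1 / real p ^ k)) y)"
      by (intro sum.cong refl) (auto simp: A_def)
    also have "\<dots> \<le> (\<Sum>y\<in>A. (\<lambda>(p, k). ln (real p) * (1 / real p ^ k)) y)"
      by (intro sum_mono2) (auto simp: A_def)
    also have "\<dots> = (\<Sum>p=2..x. \<Sum>k=2..x. ln (real p) * (1 / real p ^ k))"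
      unfolding A_def by (rule sum.cartesian_product [symmetric])
    also have "\<dots> \<le> (\<Sum>p=2..x. 4 * real p powr (- 3 / 2))"
    proof (rule sum_mono)
      fix p assume p: "p \<in> {2..x}"
      have "(\<Sum>k=2..x. ln (real p) * (1 / real p ^ k)) = ln (real p) * (\<Sum>k=2..x. 1 / real p ^ k)"
        by (rule sum_distrib_left [symmetric])
      also have "\<dots> \<le> ln (real p) * (2 / real p ^ 2)"
        using p by (intro mult_left_mono sum_geometric_tail_le) auto
      also have "\<dots> = 2 * (ln (real p) / real p ^ 2)" by simp
      also have "\<dots> \<le> 2 * (2 * real p powr (- 3 / 2))" by (intro mult_left_mono ln_div_square_le) auto
      finally show "(\<Sum>k=2..x. ln (real p) * (1 / real p ^ k)) \<le> 4 * real p powr (- 3 / 2)" by simp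
    qed
    also have "\<dots> \<le> (\<Sum>n. 4 * real n powr (- 3 / 2))"
      by (intro sum_le_suminf summ) auto
    finally show ?thesis .
  qed
  then show ?thesis by blast
qed

lemma mangoldt_sum_principal_ge:
  assumes N: "N > 0"
  shows "\<exists>C. \<forall>x>0. ln (real x) - C \<le> Re (mangoldt_sum_char (principal_char N) x)"
proof -
  obtain C where C: "\<And>x. (\<Sum>d | d \<in> {1..x} \<and> \<not> prime d. mangoldt d / real d) \<le> C"
    using mangoldt_nonprime_bounded by blast
  define g where "g d = (mangoldt d / real d :: real)" for d
  have g0: "g d \<ge> 0" for d unfolding g_def by (intro divide_nonneg_nonneg mangoldt_nonneg) auto
  define D where "D = (\<Sum>d=1..N. g d)"
  have "ln (real x) - (1 + C + D) \<le> Re (mangoldt_sum_char (principal_char N) x)" if x: "x > 0" for x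
  proof -
    have "ln (real x) - 1 \<le> (\<Sum>d=1..x. g d)" using mertens_ge[OF x] by (simp add: g_def)
    also have "\<dots> = (\<Sum>d | d \<in> {1..x} \<and> coprime d N. g d) + (\<Sum>d | d \<in> {1..x} \<and> \<not> coprime d N. g d)"
    proof -
      have "{1..x} = {d. d \<in> {1..x} \<and> coprime d N} \<union> {d. d \<in> {1..x} \<and> \<not> coprime d N}" by auto
      then show ?thesis by (metis (mono_tags, lifting) sum.union_disjoint finite_Un finite_atLeastAtMost disjoint_iff mem_Collect_eq)
    qed
    also have "(\<Sum>d | d \<in> {1..x} \<and> \<not> coprime d N. g d) \<le> (\<Sum>d\<in>{d. d \<in> {1..x} \<and> \<not> prime d} \<union> {1..N}. g d)"
    proof (rule sum_mono2)
      have "d \<le> N" if "prime d" "\<not> coprime d N" for d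
        using that prime_imp_coprime[of d N] N by (meson dvd_imp_le)
      then show "{d. d \<in> {1..x} \<and> \<not> coprime d N} \<subseteq> {d. d \<in> {1..x} \<and> \<not> prime d} \<union> {1..N}"
        by auto
    qed (use g0 in auto)
    also have "\<dots> \<le> (\<Sum>d | d \<in> {1..x} \<and> \<not> prime d. g d) + (\<Sum>d=1..N. g d)"
      by (rule sum_Un_le) (use g0 in auto)
    also have "(\<Sum>d | d \<in> {1..x} \<and> \<not> prime d. g d) \<le> C" unfolding g_def by (rule C)
    also have "(\<Sum>d | d \<in> {1..x} \<and> coprime d N. g d) = Re (mangoldt_sum_char (principal_char N) x)"
    proof -
      have "Re (mangoldt_sum_char (principal_char N) x) = (\<Sum>d=1..x. if coprime d N then g d else 0)"
        unfolding mangoldt_sum_char_def Re_sum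
        by (intro sum.cong refl) (auto simp: principal_char_def g_def)
      also have "\<dots> = (\<Sum>d | d \<in> {1..x} \<and> coprime d N. g d)"
        by (rule sum.inter_filter [symmetric]) simp
      finally show ?thesis ..
    qed
    finally show ?thesis by (simp add: D_def)
  qed
  then show ?thesis by blast
qed

text \<open>By orthogonality the sum of \<open>\<Lambda>(d)/d\<close> over \<open>d \<equiv> r\<close> modulo \<open>N\<close> is a mean over the characters, in which only
  the principal one is unbounded. So this sum diverges, while proper prime powers
  and finitely many primes would give a bounded one.\<close>

theorem infinitely_many_primes_in_arithmetic_progression:
  fixes r N B :: nat
  assumes N: "N > 0" and r: "coprime r N"
  shows "\<exists>p. prime p \<and> p > B \<and> [p = r] (mod N)"
proof (rule ccontr)
  assume "\<not> ?thesis"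
  then have no: "p \<le> B" if "prime p" "[p = r] (mod N)" for p using that by (meson not_le)
  obtain C where C: "\<And>x. (\<Sum>d | d \<in> {1..x} \<and> \<not> prime d. mangoldt d / real d) \<le> C"
    using mangoldt_nonprime_bounded by blast
  obtain P where P: "\<And>x. x > 0 \<Longrightarrow> ln (real x) - P \<le> Re (mangoldt_sum_char (principal_char N) x)"
    using mangoldt_sum_principal_ge[OF N] by blast
  have "\<exists>M. \<forall>x. norm (mangoldt_sum_char h x) \<le> M" if h: "h \<in> dchars N" "h \<noteq> principal_char N" for h
  proof -
    obtain L where L: "has_L N h L" using has_L_exists[OF h N] .
    then have "L \<noteq> 0" using char_nonvanishing[OF h N] by blast
    then show ?thesis using mangoldt_sum_char_bounded[OF h N L] by blast
  qed
  then obtain M where M: "\<And>h x. h \<in> dchars N \<Longrightarrow> h \<noteq> principal_char N \<Longrightarrow> norm (mangoldt_sum_char h x) \<le> M h"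
    by metis
  define g where "g d = (mangoldt d / real d :: real)" for d
  have g0: "g d \<ge> 0" for d unfolding g_def by (intro divide_nonneg_nonneg mangoldt_nonneg) auto
  define D where "D = dchars N - {principal_char N}"
  define G where "G = C + (\<Sum>d=1..B. g d)"
  have fin: "finite (dchars N)" using finite_dchars[OF N] .
  have bound: "ln (real x) \<le> P + real (card (dchars N)) * G + (\<Sum>h\<in>D. M h)" if x: "x > 0" for x
  proof -
    have "ln (real x) - P - (\<Sum>h\<in>D. M h) \<le>
        Re (mangoldt_sum_char (principal_char N) x) + (\<Sum>h\<in>D. Re (cnj (h r) * mangoldt_sum_char h x))"
    proof -
      have "(\<Sum>h\<in>D. - M h) \<le> (\<Sum>h\<in>D. Re (cnj (h r) * mangoldt_sum_char h x))"
      proof (rule sum_mono)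
        fix h assume "h \<in> D"
        then have h: "h \<in> dchars N" "h \<noteq> principal_char N" by (auto simp: D_def)
        have "norm (cnj (h r) * mangoldt_sum_char h x) \<le> 1 * M h"
          unfolding norm_mult using norm_dchars_le[OF h(1) N, of r] M[OF h] by (intro mult_mono) auto
        then show "- M h \<le> Re (cnj (h r) * mangoldt_sum_char h x)"
          using abs_Re_le_cmod[of "cnj (h r) * mangoldt_sum_char h x"] by linarith
      qed
      then show ?thesis using P[OF x] by (simp add: sum_negf)
    qed
    also have "\<dots> = Re (\<Sum>h\<in>dchars N. cnj (h r) * mangoldt_sum_char h x)"
      using fin principal_char_in_dchars[OF N] r
      by (simp add: D_def sum.remove[of _ "principal_char N"] principal_char_def)
    also have "(\<Sum>h\<in>dchars N. cnj (h r) * mangoldt_sum_char h x)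
        = (\<Sum>d=1..x. (\<Sum>h\<in>dchars N. cnj (h r) * h d) * mangoldt d / of_nat d)"
      unfolding mangoldt_sum_char_def sum_distrib_left
      by (subst sum.swap) (simp add: sum_distrib_right sum_divide_distrib mult.assoc)
    also have "\<dots> = of_real (real (card (dchars N)) * (\<Sum>d=1..x. if [d = r] (mod N) then g d else 0))"
      unfolding of_real_mult of_real_sum sum_distrib_left
      by (intro sum.cong refl) (simp add: sum_dchars_cnj[OF N r] g_def)
    also have "Re \<dots> = real (card (dchars N)) * (\<Sum>d=1..x. if [d = r] (mod N) then g d else 0)"
      by (rule Re_complex_of_real)
    also have "\<dots> \<le> real (card (dchars N)) * G"
    proof (rule mult_left_mono)
      have "(\<Sum>d=1..x. if [d = r] (mod N) then g d else 0) = (\<Sum>d | d \<in> {1..x} \<and> [d = r] (mod N). g d)"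
        by (rule sum.inter_filter [symmetric]) simp
      also have "\<dots> \<le> (\<Sum>d\<in>{d. d \<in> {1..x} \<and> \<not> prime d} \<union> {1..B}. g d)"
        by (rule sum_mono2) (use g0 no in auto)
      also have "\<dots> \<le> (\<Sum>d | d \<in> {1..x} \<and> \<not> prime d. g d) + (\<Sum>d=1..B. g d)"
        by (rule sum_Un_le) (use g0 in auto)
      also have "(\<Sum>d | d \<in> {1..x} \<and> \<not> prime d. g d) \<le> C" unfolding g_def by (rule C)
      finally show "(\<Sum>d=1..x. if [d = r] (mod N) then g d else 0) \<le> G" by (simp add: G_def)
    qed simp
    finally show ?thesis by simp
  qed
  define T where "T = P + real (card (dchars N)) * G + (\<Sum>h\<in>D. M h)"
  obtain x :: nat where x: "exp (T + 1) < real x" using reals_Archimedean2 by blast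
  then have "x > 0" by (metis exp_gt_zero less_trans of_nat_0_less_iff)
  then have "ln (exp (T + 1)) < ln (real x)" using x by (subst ln_less_cancel_iff) auto
  then show False using bound[OF \<open>x > 0\<close>] by (simp add: T_def)
qed

lemma dirichlet_int:
  fixes r N :: int
  assumes "N \<noteq> 0" "coprime r N"
  shows "\<exists>p. prime p \<and> p > B \<and> [int p = r] (mod N)"
proof -
  define M where "M = nat \<bar>N\<bar>"
  define r' where "r' = nat (r mod \<bar>N\<bar>)"
  have M: "int M = \<bar>N\<bar>" "M > 0" and r': "int r' = r mod \<bar>N\<bar>" using assms(1) by (auto simp: M_def r'_def)
  have "coprime (r mod \<bar>N\<bar>) \<bar>N\<bar>" using assms by (subst coprime_mod_left_iff) auto
  then have "coprime (int r') (int M)" unfolding r' M(1) .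
  then have "coprime r' M" by (simp only: coprime_int_iff)
  then obtain p where p: "prime p" "p > B" "[p = r'] (mod M)"
    using infinitely_many_primes_in_arithmetic_progression[OF M(2)] by blast
  from p(3) have "[int p = int r'] (mod int M)" by (simp only: cong_int_iff)
  then have "[int p = r] (mod \<bar>N\<bar>)" unfolding r' M(1) by (simp add: cong_def)
  then have "[int p = r] (mod N)" by (simp add: cong_iff_dvd_diff)
  then show ?thesis using p by blast
qed

section \<open>Powers of an integer modulo powers of a prime\<close>

lemma one_plus_power_mod_square: "\<exists>y. (1 + x) ^ k = 1 + int k * x + x\<^sup>2 * (y :: int)"
proof (induction k)
  case 0
  show ?case by (intro exI[of _ 0]) simp
next
  case (Suc k)
  then obtain y where y: "(1 + x) ^ k = 1 + int k * x + x\<^sup>2 * y" by blast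
  show ?case
    by (rule exI[of _ "int k + y + x * y"]) (simp add: y algebra_simps power2_eq_square)
qed

lemma one_plus_power_mod_cube:
  "\<exists>y. (1 + x) ^ k = 1 + int k * x + int (k choose 2) * x\<^sup>2 + x ^ 3 * (y :: int)"
proof (induction k)
  case 0
  show ?case by (intro exI[of _ 0]) simp
next
  case (Suc k)
  then obtain y where y: "(1 + x) ^ k = 1 + int k * x + int (k choose 2) * x\<^sup>2 + x ^ 3 * y" by blast
  have "Suc k choose 2 = k + (k choose 2)" by (simp add: numeral_2_eq_2)
  then show ?case
    by (intro exI[of _ "int (k choose 2) + y + x * y"])
       (simp add: y algebra_simps power2_eq_square power3_eq_cube)
qed

lemma euler_theorem_int:
  fixes a m :: int
  assumes "m \<noteq> 0" "coprime a m"
  shows "[a ^ totient (nat \<bar>m\<bar>) = 1] (mod m)"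
proof -
  define b where "b = nat (a mod \<bar>m\<bar>)"
  have b: "int b = a mod \<bar>m\<bar>" using assms(1) by (simp add: b_def)
  have "coprime (a mod \<bar>m\<bar>) \<bar>m\<bar>"
    using assms by (subst coprime_mod_left_iff) auto
  then have "coprime (int b) (int (nat \<bar>m\<bar>))" unfolding b by simp
  then have "coprime b (nat \<bar>m\<bar>)" by (simp only: coprime_int_iff)
  from euler_theorem[OF this] have "[int (b ^ totient (nat \<bar>m\<bar>)) = int 1] (mod int (nat \<bar>m\<bar>))"
    by (simp only: cong_int_iff)
  then have "[int b ^ totient (nat \<bar>m\<bar>) = 1] (mod \<bar>m\<bar>)" by simp
  then have "[a ^ totient (nat \<bar>m\<bar>) = 1] (mod \<bar>m\<bar>)"
    unfolding b by (simp add: cong_def power_mod)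
  then show ?thesis by (simp add: cong_iff_dvd_diff)
qed

text \<open>Raising to the \<open>q\<close>-th power moves a unit exactly one level down in the \<open>q\<close>-adic
  filtration; oddness of \<open>q\<close> is what makes the quadratic term negligible.\<close>

lemma one_plus_prime_power_power:
  fixes w :: int
  assumes "prime q" "odd q" "n \<ge> 1" "\<not> int q dvd w"
  shows "\<exists>w'. (1 + int q ^ n * w) ^ q = 1 + int q ^ Suc n * w' \<and> \<not> int q dvd w'"
proof -
  define x where "x = int q ^ n * w"
  obtain y where y: "(1 + x) ^ q = 1 + int q * x + int (q choose 2) * x\<^sup>2 + x ^ 3 * y"
    using one_plus_power_mod_cube by blast
  obtain h where h: "q = 2 * h + 1" using assms(2) by (auto elim: oddE)
  have "q choose 2 = q * h" by (simp add: choose_two h)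
  then have c: "int (q choose 2) = int q * int h" by simp
  obtain j where j: "n = Suc j" using assms(3) by (cases n) auto
  define z where "z = int q ^ j * int h * w\<^sup>2 + int q ^ (2 * j) * w ^ 3 * y"
  have x2: "int q * x\<^sup>2 = int q ^ Suc n * int q * (int q ^ j * w\<^sup>2)"
    by (simp add: x_def j power2_eq_square algebra_simps)
  have x3: "x ^ 3 = int q ^ Suc n * int q * (int q ^ (2 * j) * w ^ 3)"
    by (simp add: x_def j power3_eq_cube algebra_simps power_add mult_2_right)
  have "(1 + x) ^ q = 1 + int q * x + int h * (int q * x\<^sup>2) + x ^ 3 * y"
    by (simp add: y c)
  also have "\<dots> = 1 + int q ^ Suc n * (w + int q * z)"
    unfolding x2 x3 z_def by (simp add: x_def algebra_simps)
  finally have "(1 + x) ^ q = 1 + int q ^ Suc n * (w + int q * z)" .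
  moreover have "\<not> int q dvd w + int q * z" using assms(4) by (simp add: dvd_add_left_iff)
  ultimately show ?thesis unfolding x_def by blast
qed

lemma power_tower_exact:
  fixes v w :: int
  assumes "prime q" "odd q" "k \<ge> 1" "v = 1 + int q ^ k * w" "\<not> int q dvd w"
  shows "\<exists>w'. v ^ (q ^ n) = 1 + int q ^ (k + n) * w' \<and> \<not> int q dvd w'"
proof (induction n)
  case 0
  show ?case using assms by auto
next
  case (Suc n)
  then obtain w' where w': "v ^ (q ^ n) = 1 + int q ^ (k + n) * w'" "\<not> int q dvd w'" by blast
  have "v ^ (q ^ Suc n) = (v ^ (q ^ n)) ^ q" by (simp add: mult.commute flip: power_mult)
  then show ?case
    using one_plus_prime_power_power[of q "k + n" w'] assms(1-3) w' by simp
qed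

text \<open>The \<open>q\<close>-adic closure of the powers of \<open>v\<close> contains \<open>1 + q\<^sup>k \<int>\<^sub>q\<close>, where \<open>k\<close> is the exact level of
  some power of \<open>v\<close>. Each induction step corrects one more \<open>q\<close>-adic digit.\<close>

lemma power_multiple_lift:
  fixes v w p a :: int
  assumes q: "prime q" "odd q" and k: "k \<ge> 1" "v ^ l = 1 + int q ^ k * w" "\<not> int q dvd w"
    and v: "\<not> int q dvd v" "\<not> int q dvd p" and pa: "[p = a] (mod int q ^ k)"
  shows "\<exists>j. [v ^ j * p = a] (mod int q ^ (k + n))"
proof (induction n)
  case 0
  show ?case using pa by (intro exI[of _ 0]) simp
next
  case (Suc n)
  then obtain j where "[v ^ j * p = a] (mod int q ^ (k + n))" by blast
  then obtain z where z: "v ^ j * p = a + int q ^ (k + n) * z"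
    by (metis cong_iff_lin cong_sym)
  obtain w' where w': "v ^ (l * q ^ n) = 1 + int q ^ (k + n) * w'" "\<not> int q dvd w'"
    using power_tower_exact[OF q k] by (auto simp: power_mult)
  have pq: "prime (int q)" using q by simp
  have "\<not> int q dvd v ^ j * p * w'"
    using v w'(2) pq by (auto simp: prime_dvd_mult_iff dest: prime_dvd_power[OF pq])
  then have "coprime (v ^ j * p * w') (int q)"
    using prime_imp_coprime[OF pq] coprime_commute by blast
  then obtain i0 where i0: "[v ^ j * p * w' * i0 = - z] (mod int q)"
    using cong_solve_dvd_int[of "v ^ j * p * w'" "int q" "- z"] by auto
  define i where "i = nat (i0 mod int q)"
  have "int i = i0 mod int q" using prime_gt_0_nat[OF q(1)] by (simp add: i_def)
  then have "[v ^ j * p * w' * int i = v ^ j * p * w' * i0] (mod int q)"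
    by (simp add: cong_def mod_mult_right_eq)
  then have "[v ^ j * p * w' * int i = - z] (mod int q)" using i0 by (rule cong_trans)
  then obtain z' where z': "v ^ j * p * w' * int i = - z + int q * z'"
    by (metis cong_iff_lin cong_sym)
  define x where "x = int q ^ (k + n) * w'"
  obtain y where y: "(1 + x) ^ i = 1 + int i * x + x\<^sup>2 * y"
    using one_plus_power_mod_square by blast
  obtain f where f: "k = Suc f" using k(1) by (cases k) auto
  have x2: "x\<^sup>2 = int q ^ (k + Suc n) * (int q ^ (f + n) * w'\<^sup>2)"
    by (simp add: x_def f power2_eq_square power_add algebra_simps)
  have "v ^ (l * q ^ n * i + j) * p = (v ^ (l * q ^ n)) ^ i * (v ^ j * p)"
    by (simp add: power_add power_mult)
  also have "\<dots> = (1 + x) ^ i * (v ^ j * p)"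
    by (simp only: w'(1) x_def)
  also have "\<dots> = v ^ j * p + x * (int i * (v ^ j * p)) + x\<^sup>2 * y * (v ^ j * p)"
    unfolding y by (simp add: algebra_simps)
  also have "\<dots> = v ^ j * p + int q ^ (k + n) * (v ^ j * p * w' * int i) + x\<^sup>2 * y * (v ^ j * p)"
    by (simp add: x_def mult_ac)
  also have "\<dots> = a + int q ^ (k + Suc n) * (z' + int q ^ (f + n) * w'\<^sup>2 * y * (v ^ j * p))"
    unfolding z' unfolding z x2 by (simp add: algebra_simps)
  finally have "[v ^ (l * q ^ n * i + j) * p = a] (mod int q ^ (k + Suc n))"
    by (simp add: cong_iff_dvd_diff)
  then show ?case by blast
qed

section \<open>Two by two matrices and the ring of fractions\<close>

lemma mat2_nth [simp]:
  "mat2 a b c d $ 1 $ 1 = a" "mat2 a b c d $ 1 $ 2 = b"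
  "mat2 a b c d $ 2 $ 1 = c" "mat2 a b c d $ 2 $ 2 = d"
  by (simp_all add: mat2_def)

lemma mat2_mult [simp]:
  "mat2 a b c d ** mat2 a' b' c' d' =
     mat2 (a * a' + b * c') (a * b' + b * d') (c * a' + d * c') (c * b' + d * d')"
  by (simp add: vec_eq_iff forall_2 matrix_matrix_mult_def sum_2 mat2_def)

lemma mat2_eq_iff: "A = mat2 a b c d \<longleftrightarrow> A $ 1 $ 1 = a \<and> A $ 1 $ 2 = b \<and> A $ 2 $ 1 = c \<and> A $ 2 $ 2 = d"
  by (auto simp: vec_eq_iff forall_2 mat2_def)

lemma mat2_eta: "A = mat2 (A $ 1 $ 1) (A $ 1 $ 2) (A $ 2 $ 1) (A $ 2 $ 2)"
  by (simp add: mat2_eq_iff)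

lemma det_mat2 [simp]: "det (mat2 a b c d) = a * d - b * c"
  by (simp add: det_2)

lemma mat_1_eq_mat2: "mat 1 = mat2 1 0 0 1"
  by (simp add: mat2_eq_iff mat_def)

lemma mat2_in_SL2R [simp]: "mat2 a b c d \<in> carrier SL2R \<longleftrightarrow> a * d - b * c = 1"
  by (simp add: SL2R_def)

lemma inv_SL2R_mat2:
  assumes "a * d - b * c = 1"
  shows "inv\<^bsub>SL2R\<^esub> (mat2 a b c d) = mat2 d (- b) (- c) a"
proof (rule group.inv_equality[OF group_SL2R])
  show "mat2 d (- b) (- c) a \<otimes>\<^bsub>SL2R\<^esub> mat2 a b c d = \<one>\<^bsub>SL2R\<^esub>"
    using assms by (simp add: SL2R_def mat_1_eq_mat2 mat2_eq_iff algebra_simps)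
qed (use assms in \<open>simp_all add: algebra_simps\<close>)

lemma of_int_in_Z_inv [simp]: "of_int a \<in> Z_inv t"
  unfolding Z_inv_def by (rule CollectI, rule exI[of _ a], rule exI[of _ 0]) simp

lemma zero_in_Z_inv [simp]: "0 \<in> Z_inv t"
  and one_in_Z_inv [simp]: "1 \<in> Z_inv t"
  using of_int_in_Z_inv[of 0 t] of_int_in_Z_inv[of 1 t] by simp_all

lemma divide_power_in_Z_inv [simp]: "of_int a / of_int t ^ n \<in> Z_inv t"
  unfolding Z_inv_def by blast

lemma uminus_in_Z_inv: "x \<in> Z_inv t \<Longrightarrow> - x \<in> Z_inv t"
  unfolding Z_inv_def by (force simp: minus_divide_left simp flip: of_int_minus)

lemma minus_one_in_Z_inv [simp]: "- 1 \<in> Z_inv t"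
  using uminus_in_Z_inv[OF one_in_Z_inv] .

lemma mult_in_Z_inv:
  assumes "x \<in> Z_inv t" "y \<in> Z_inv t"
  shows "x * y \<in> Z_inv t"
proof -
  obtain a n b k where "x = of_int a / of_int t ^ n" "y = of_int b / of_int t ^ k"
    using assms by (auto simp: Z_inv_def)
  then have "x * y = of_int (a * b) / of_int t ^ (n + k)" by (simp add: power_add)
  then show ?thesis unfolding Z_inv_def by blast
qed

lemma add_in_Z_inv:
  assumes "t \<noteq> 0" "x \<in> Z_inv t" "y \<in> Z_inv t"
  shows "x + y \<in> Z_inv t"
proof -
  obtain a n b k where "x = of_int a / of_int t ^ n" "y = of_int b / of_int t ^ k"
    using assms by (auto simp: Z_inv_def)
  then have "x + y = of_int (a * t ^ k + b * t ^ n) / of_int t ^ (n + k)"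
    using assms(1) by (simp add: power_add add_divide_distrib)
  then show ?thesis unfolding Z_inv_def by blast
qed

lemma diff_in_Z_inv: "t \<noteq> 0 \<Longrightarrow> x \<in> Z_inv t \<Longrightarrow> y \<in> Z_inv t \<Longrightarrow> x - y \<in> Z_inv t"
  using add_in_Z_inv[of t x "- y"] uminus_in_Z_inv[of y t] by simp

lemma power_in_Z_inv: "x \<in> Z_inv t \<Longrightarrow> x ^ n \<in> Z_inv t"
  by (induction n) (auto intro: mult_in_Z_inv)

lemma Z_inv_clear_denominator:
  assumes "t \<noteq> 0" "x \<in> Z_inv t"
  obtains a n where "x * of_int t ^ n = of_int a" "n > 0"
proof -
  obtain a n where "x = of_int a / of_int t ^ n"
    using assms by (auto simp: Z_inv_def)
  then have "x * of_int t ^ Suc n = of_int (a * t)"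
    using assms(1) by simp
  then show ?thesis using that by blast
qed

section \<open>The group generated by the two unipotent matrices\<close>

lemma Gamma_gen_mult:
  assumes "A \<in> Gamma_gen q" "B \<in> Gamma_gen q"
  shows "A ** B \<in> Gamma_gen q"
  using generate.eng[OF assms[unfolded Gamma_gen_def]] by (simp add: Gamma_gen_def SL2R_def)

lemma Gamma_gen_carrier:
  assumes "A \<in> Gamma_gen q"
  shows "det A = 1"
proof -
  have "A \<in> carrier SL2R"
    using assms unfolding Gamma_gen_def
    by (rule group.generate_in_carrier[OF group_SL2R, rotated]) auto
  then show ?thesis by (simp add: SL2R_def)
qed

lemma Gamma_gen_inverse:
  assumes "mat2 a b c d \<in> Gamma_gen q"
  shows "mat2 d (- b) (- c) a \<in> Gamma_gen q"
proof -
  have "inv\<^bsub>SL2R\<^esub> (mat2 a b c d) \<in> Gamma_gen q"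
    using assms unfolding Gamma_gen_def
    by (intro group.generate_m_inv_closed[OF group_SL2R]) auto
  then show ?thesis
    using inv_SL2R_mat2[of a d b c] Gamma_gen_carrier[OF assms] by simp
qed

lemma Gamma_gen_upper_of_nat: "mat2 1 (of_nat n) 0 1 \<in> Gamma_gen q"
proof (induction n)
  case 0
  have "\<one>\<^bsub>SL2R\<^esub> \<in> Gamma_gen q" unfolding Gamma_gen_def by (rule generate.one)
  then show ?case by (simp add: SL2R_def mat_1_eq_mat2)
next
  case (Suc n)
  have "mat2 1 1 0 1 \<in> Gamma_gen q"
    unfolding Gamma_gen_def by (rule generate.incl) simp
  from Gamma_gen_mult[OF this Suc] show ?case by (simp add: add.commute)
qed

lemma Gamma_gen_lower_of_nat: "mat2 1 0 (of_rat q * of_nat n) 1 \<in> Gamma_gen q"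
proof (induction n)
  case 0
  then show ?case using Gamma_gen_upper_of_nat[of 0 q] by simp
next
  case (Suc n)
  have "mat2 1 0 (of_rat q) 1 \<in> Gamma_gen q"
    unfolding Gamma_gen_def by (rule generate.incl) simp
  from Gamma_gen_mult[OF this Suc] show ?case by (simp add: algebra_simps)
qed

lemma Gamma_gen_upper_of_int: "mat2 1 (of_int k) 0 1 \<in> Gamma_gen q"
proof (cases "k \<ge> 0")
  case True
  then show ?thesis using Gamma_gen_upper_of_nat[of "nat k" q] by simp
next
  case False
  then show ?thesis using Gamma_gen_inverse[OF Gamma_gen_upper_of_nat[of "nat (- k)" q]] by simp
qed

lemma Gamma_gen_lower_of_int: "mat2 1 0 (of_rat q * of_int k) 1 \<in> Gamma_gen q"
proof (cases "k \<ge> 0")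
  case True
  then show ?thesis using Gamma_gen_lower_of_nat[of q "nat k"] by simp
next
  case False
  then show ?thesis using Gamma_gen_inverse[OF Gamma_gen_lower_of_nat[of q "nat (- k)"]] by simp
qed

text \<open>Naming the sign \<open>e\<close> and the quotient \<open>m\<close> treats both congruences at once, with explicit matrices.\<close>

locale unit_one_mod =
  fixes s t e m :: int
  assumes e: "e = 1 \<or> e = - 1" and t: "t = e + s * m" and s0: "s \<noteq> 0" and t2: "\<bar>t\<bar> \<ge> 2"
begin

abbreviation R :: "real set" where "R \<equiv> Z_inv t"
abbreviation H :: "(real^2^2) set" where "H \<equiv> Gamma_gen (of_int s / of_int t)"
definition u :: int where "u = e * t"

lemma t0 [simp]: "t \<noteq> 0" using t2 by auto
lemma e_sq [simp]: "e * e = 1" using e by auto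
lemma u_eq: "u = 1 + s * (e * m)"
proof -
  have "u = e * (e + s * m)" by (simp add: u_def flip: t)
  then show ?thesis by (simp add: distrib_left mult.left_commute)
qed
lemma u0 [simp]: "u \<noteq> 0" using e by (auto simp: u_def)
lemma abs_u: "\<bar>u\<bar> \<ge> 2" using e t2 by (auto simp: u_def)
lemma coprime_s_t: "coprime s t"
proof (rule coprimeI)
  fix d assume "d dvd s" "d dvd t"
  then have "d dvd t - s * m" by simp
  then show "is_unit d" using e unfolding t by auto
qed

lemma cong_u: "[u = 1] (mod s)"
  by (simp add: u_eq cong_iff_dvd_diff)

lemma inverse_u_in_R: "1 / of_int u \<in> R"
proof -
  have "1 / of_int u = of_int e / (of_int t :: real) ^ 1" using e by (auto simp: u_def)
  then show ?thesis by (metis divide_power_in_Z_inv)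
qed

lemma of_int_divide_u_in_R: "of_int k / of_int u ^ n \<in> R"
  using mult_in_Z_inv[OF of_int_in_Z_inv[of k] power_in_Z_inv[OF inverse_u_in_R, of n]]
  by (simp add: power_one_over)

text \<open>Even powers are the denominators needed later, since conjugation by a matrix with diagonal \<open>(u, 1/u)\<close>
  scales the unipotent groups by \<open>u\<^sup>2\<close>.\<close>

lemma R_even_denominator:
  assumes "x \<in> R"
  obtains k n where "x = of_int k / of_int u ^ (2 * n)"
proof -
  obtain a n where x: "x = of_int a / of_int t ^ n" using assms by (auto simp: Z_inv_def)
  have "(of_int u :: real) ^ (2 * n) = of_int t ^ n * of_int t ^ n"
    using e by (auto simp: u_def mult_2 power_add power_mult_distrib simp flip: power_mult)
  then have "x = of_int (a * t ^ n) / of_int u ^ (2 * n)"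
    unfolding x by simp
  then show ?thesis using that by blast
qed

lemma q_of_rat: "of_rat (of_int s / of_int t) = (of_int s / of_int t :: real)"
  by (simp add: of_rat_divide)

text \<open>This is where \<open>t = e + s m\<close> is used: subtracting \<open>m\<close> times the second row from the first turns the entry
  \<open>1\<close> of the lower generator into \<open>1 - m s / t = e / t\<close>, a unit of infinite order.\<close>

lemma lower_triangular_in_H: "mat2 (1 / of_int u) 0 (of_int s / of_int t) (of_int u) \<in> H"
proof -
  have 1: "mat2 1 (of_int (- m)) 0 1 \<in> H" "mat2 1 (of_int (u * m)) 0 1 \<in> H"
    by (rule Gamma_gen_upper_of_int)+
  have 2: "mat2 1 0 (of_int s / of_int t) 1 \<in> H"
    using Gamma_gen_lower_of_int[of "of_int s / of_int t" 1] by (simp add: q_of_rat)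
  have tr: "(of_int t :: real) = of_int e + of_int s * of_int m"
    by (subst t) simp
  have eu: "1 - of_int m * of_int s / of_int t = (of_int e / of_int t :: real)"
  proof -
    have "of_int t - of_int m * of_int s = (of_int e :: real)" using tr by simp
    then have "(of_int t - of_int m * of_int s) / of_int t = (of_int e / of_int t :: real)" by simp
    then show ?thesis by (simp add: diff_divide_distrib)
  qed
  have iu: "1 / of_int u = (of_int e / of_int t :: real)"
    using e by (auto simp: u_def)
  have us: "of_int s / of_int t * of_int (u * m) + 1 = (of_int u :: real)"
  proof -
    have "of_int s / of_int t * of_int (u * m) = (of_int s * (of_int e * of_int m) :: real)"
      by (simp add: u_def)
    then show ?thesis by (subst (2) u_eq) simp
  qed
  have "mat2 1 (of_int (- m)) 0 1 ** mat2 1 0 (of_int s / of_int t) 1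
      = mat2 (1 / of_int u) (- of_int m) (of_int s / of_int t) 1"
    using eu iu by (simp add: mat2_eq_iff)
  moreover have "\<dots> ** mat2 1 (of_int (u * m)) 0 1
      = mat2 (1 / of_int u) 0 (of_int s / of_int t) (of_int u)"
    using us by (simp add: mat2_eq_iff)
  ultimately show ?thesis using Gamma_gen_mult[OF Gamma_gen_mult[OF 1(1) 2] 1(2)] by simp
qed

lemma lower_triangular_inv_in_H: "mat2 (of_int u) 0 (- (of_int s / of_int t)) (1 / of_int u) \<in> H"
  using Gamma_gen_inverse[OF lower_triangular_in_H] by simp

lemma lower_shrink:
  assumes "mat2 1 0 y 1 \<in> H"
  shows "mat2 1 0 (y / of_int u ^ 2) 1 \<in> H"
proof -
  have "mat2 (of_int u) 0 (- (of_int s / of_int t)) (1 / of_int u) ** mat2 1 0 y 1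
          ** mat2 (1 / of_int u) 0 (of_int s / of_int t) (of_int u) = mat2 1 0 (y / of_int u ^ 2) 1"
    by (simp add: mat2_eq_iff field_simps power2_eq_square)
  then show ?thesis using Gamma_gen_mult[OF Gamma_gen_mult[OF lower_triangular_inv_in_H assms] lower_triangular_in_H] by simp
qed

lemma lower_in_H:
  assumes "y \<in> R"
  shows "mat2 1 0 (of_int s * y) 1 \<in> H"
proof -
  obtain k n where y: "y = of_int k / of_int u ^ (2 * n)" using R_even_denominator[OF assms] .
  have "mat2 1 0 (of_int s * of_int k / of_int u ^ (2 * n)) 1 \<in> H" for k
  proof (induction n)
    case 0
    show ?case using Gamma_gen_lower_of_int[of "of_int s / of_int t" "t * k"] by (simp add: q_of_rat)
  next
    case (Suc n)
    show ?case using lower_shrink[OF Suc] by (simp add: power2_eq_square mult_ac)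
  qed
  then show ?thesis by (simp add: y)
qed

lemma diagonal_in_H: "mat2 (of_int u) 0 0 (1 / of_int u) \<in> H"
proof -
  have "of_int s * (of_int (- e) / of_int t ^ 2) = - (of_int s / of_int t / of_int u :: real)"
    using e by (auto simp: u_def power2_eq_square)
  then have "mat2 1 0 (- (of_int s / of_int t / of_int u)) 1 \<in> H"
    using lower_in_H[of "of_int (- e) / of_int t ^ 2"] by (metis divide_power_in_Z_inv)
  from Gamma_gen_mult[OF lower_triangular_in_H this] have "mat2 (1 / of_int u) 0 0 (of_int u) \<in> H" by simp
  from Gamma_gen_inverse[OF this] show ?thesis by simp
qed

lemma diagonal_inv_in_H: "mat2 (1 / of_int u) 0 0 (of_int u) \<in> H"
  using Gamma_gen_inverse[OF diagonal_in_H] by simp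

lemma upper_in_H:
  assumes "x \<in> R"
  shows "mat2 1 x 0 1 \<in> H"
proof -
  obtain k n where x: "x = of_int k / of_int u ^ (2 * n)" using R_even_denominator[OF assms] .
  have "mat2 1 (of_int k / of_int u ^ (2 * n)) 0 1 \<in> H"
  proof (induction n)
    case 0
    show ?case using Gamma_gen_upper_of_int[of k] by simp
  next
    case (Suc n)
    have "mat2 (1 / of_int u) 0 0 (of_int u) ** mat2 1 (of_int k / of_int u ^ (2 * n)) 0 1
            ** mat2 (of_int u) 0 0 (1 / of_int u) = mat2 1 (of_int k / of_int u ^ (2 * Suc n)) 0 1"
      by (simp add: mat2_eq_iff)
    then show ?case using Gamma_gen_mult[OF Gamma_gen_mult[OF diagonal_inv_in_H Suc] diagonal_in_H] by simp
  qed
  then show ?thesis by (simp add: x)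
qed

section \<open>Reduction of first columns\<close>

text \<open>Membership of a matrix in \<open>H\<close> depends only on its first column, up to upper unipotent
  factors. The second entry is divided by \<open>s\<close>, which makes the two entries play nearly symmetric roles.\<close>

definition reducible :: "real \<Rightarrow> real \<Rightarrow> bool" where
  "reducible a c \<longleftrightarrow> (\<exists>b d. mat2 a b (of_int s * c) d \<in> H)"

lemma reducible_add_left:
  assumes "reducible a c" "x \<in> R"
  shows "reducible (a + x * (of_int s * c)) c"
proof -
  obtain b d where "mat2 a b (of_int s * c) d \<in> H" using assms(1) by (auto simp: reducible_def)
  from Gamma_gen_mult[OF upper_in_H[OF assms(2)] this] show ?thesis
    by (auto simp: reducible_def)
qed

lemma reducible_add_right:
  assumes "reducible a c" "y \<in> R"
  shows "reducible a (c + y * a)"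
proof -
  obtain b d where "mat2 a b (of_int s * c) d \<in> H" using assms(1) by (auto simp: reducible_def)
  from Gamma_gen_mult[OF lower_in_H[OF assms(2)] this] show ?thesis
    by (auto simp: reducible_def algebra_simps)
qed

lemma reducible_scale:
  assumes "reducible a c"
  shows "reducible (of_int u ^ k * a) (c / of_int u ^ k)"
proof (induction k)
  case 0
  then show ?case using assms by simp
next
  case (Suc k)
  then obtain b d where "mat2 (of_int u ^ k * a) b (of_int s * (c / of_int u ^ k)) d \<in> H"
    by (auto simp: reducible_def)
  from Gamma_gen_mult[OF diagonal_in_H this] show ?case
    by (auto simp: reducible_def mult.assoc)
qed

text \<open>Starting from the column \<open>(1, 0)\<close>, a unit \<open>v\<close> can be put in the second place, and then every first entry
  congruent to 1 modulo \<open>s R\<close> is reachable by adding multiples of \<open>s v\<close>.\<close>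

lemma reducible_unit:
  assumes "v \<in> R" "1 / v \<in> R" "v \<noteq> 0" "r \<in> R"
  shows "reducible (1 + of_int s * r) v"
proof -
  have "reducible 1 0"
    using Gamma_gen_upper_of_int[of 0] by (auto simp: reducible_def)
  from reducible_add_right[OF this assms(1)] have "reducible 1 v" by simp
  from reducible_add_left[OF this, of "r / v"] show ?thesis
    using mult_in_Z_inv[OF assms(4,2)] assms(3) by (simp add: mult.commute)
qed

lemma reducible_cong_left:
  fixes a a' c :: int
  assumes "reducible (of_int a) (of_int c)" "[a' = a] (mod s * c)"
  shows "reducible (of_int a') (of_int c)"
proof -
  obtain k where "a' = a + s * c * k" using assms(2) by (metis cong_iff_lin cong_sym)
  then show ?thesis
    using reducible_add_left[OF assms(1) of_int_in_Z_inv[of k]] by (simp add: algebra_simps)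
qed

lemma reducible_cong_right:
  fixes a c c' :: int
  assumes "reducible (of_int a) (of_int c)" "[c' = c] (mod a)"
  shows "reducible (of_int a) (of_int c')"
proof -
  obtain k where "c' = c + a * k" using assms(2) by (metis cong_iff_lin cong_sym)
  then show ?thesis
    using reducible_add_right[OF assms(1) of_int_in_Z_inv[of k]] by (simp add: algebra_simps)
qed

section \<open>Coprime integer columns\<close>

text \<open>The column passes through \<open>(a, b)\<close>, \<open>(a, q)\<close>, \<open>(a, q ^ n)\<close>, \<open>(u ^ j v, q ^ n)\<close>, \<open>(v, u ^ j q ^ n)\<close> and
  \<open>(v, u ^ j g)\<close> with \<open>g = 1\<close> or \<open>g = -1\<close>. Here \<open>q\<close> and \<open>-v\<close> are primes supplied by Dirichlet's theorem and
  \<open>n = ((- v - 1) / 2)\<^sup>2\<close>.\<close>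

theorem reducible_coprime:
  fixes a b :: int
  assumes a1: "[a = 1] (mod s)" and cop: "coprime a b"
  shows "reducible (of_int a) (of_int b)"
proof (cases "a = 0")
  case True
  obtain r where r: "a = 1 + s * r" using a1 by (metis cong_iff_lin cong_sym)
  have "b = 1 \<or> b = - 1" using cop True by auto
  then have "reducible (1 + of_int s * of_int r) (of_int b)"
    by (intro reducible_unit) (auto intro: uminus_in_Z_inv)
  then show ?thesis by (simp add: r)
next
  case False
  define L where "L = totient (nat \<bar>a\<bar>)"
  have L: "L > 0" using False by (simp add: L_def)
  obtain q where q: "prime q" "q > nat \<bar>4 * s * u * a * int L\<bar>" "[int q = b] (mod a)"
    using dirichlet_int[OF False, of b] cop by (auto simp: coprime_commute)
  have pq: "prime (int q)" using q(1) by simp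
  have ndvd: "\<not> int q dvd x" if "x dvd 4 * s * u * a * int L" for x
  proof
    assume "int q dvd x"
    then have "int q dvd \<bar>4 * s * u * a * int L\<bar>" using that by (metis dvd_trans dvd_abs_iff)
    moreover have "\<bar>4 * s * u * a * int L\<bar> > 0" using s0 False L by simp
    ultimately have "int q \<le> \<bar>4 * s * u * a * int L\<bar>" by (rule zdvd_imp_le)
    then show False using q(2) by linarith
  qed
  have q_s: "\<not> int q dvd s" and q_u: "\<not> int q dvd u" and q_a: "\<not> int q dvd a"
    and q_4sL: "\<not> int q dvd 4 * s * int L" and q_2: "\<not> int q dvd 2"
    by (rule ndvd; force)+
  have odd_q: "odd q"
    using q_2 primes_dvd_imp_eq[of 2 q] q(1) by auto
  \<comment> \<open>The level \<open>k\<close> exists because \<open>u\<close> is not a root of unity.\<close>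
  have "\<bar>u\<bar> ^ 1 < \<bar>u\<bar> ^ (q - 1)" if "q - 1 > 1"
    using abs_u that by (intro power_strict_increasing) auto
  moreover have q3: "q \<ge> 3" using odd_q prime_ge_2_nat[OF q(1)] by (cases "q = 2") auto
  ultimately have "\<bar>u ^ (q - 1)\<bar> > 1" using abs_u by (auto simp: power_abs)
  then have nz: "u ^ (q - 1) - 1 \<noteq> 0" by auto
  have nu: "\<not> is_unit (int q)" using pq not_prime_unit by blast
  obtain w where w: "u ^ (q - 1) - 1 = int q ^ multiplicity (int q) (u ^ (q - 1) - 1) * w"
     "\<not> int q dvd w"
    using multiplicity_decompose'[OF nz nu] by metis
  define k where "k = multiplicity (int q) (u ^ (q - 1) - 1)"
  have "coprime u (int q)" using prime_imp_coprime[OF pq q_u] by (simp add: coprime_commute)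
  from euler_theorem_int[OF _ this] have "[u ^ (q - 1) = 1] (mod int q)"
    using q(1) q3 by (simp add: totient_prime)
  then have "int q dvd u ^ (q - 1) - 1" by (simp add: cong_iff_dvd_diff)
  then have k: "k \<ge> 1" unfolding k_def using multiplicity_gt_zero_iff[OF nz nu] by linarith
  have wk: "u ^ (q - 1) = 1 + int q ^ k * w" using w(1) by (simp add: k_def)
  \<comment> \<open>The conditions modulo \<open>4 s L\<close> control the exponent, the one modulo \<open>q ^ k\<close> permits the passage from
    \<open>a\<close> to \<open>v\<close> along powers of \<open>u\<close>; they are compatible as \<open>q\<close> is large.\<close>
  have "coprime (4 * s * int L) (int q ^ k)"
    using prime_imp_coprime[OF pq q_4sL] by (metis coprime_commute coprime_power_right_iff)
  then obtain x where x: "[x = 1] (mod 4 * s * int L)" "[x = a] (mod int q ^ k)"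
    using binary_chinese_remainder_int by blast
  have "coprime x (4 * s * int L)" using x(1) by (metis cong_imp_coprime coprime_1_left cong_sym)
  moreover have "coprime x (int q ^ k)"
    using x(2) q_a pq by (metis cong_imp_coprime prime_imp_coprime coprime_commute cong_sym coprime_power_left_iff)
  ultimately have "coprime (- x) (4 * s * int L * int q ^ k)" by simp
  moreover have "4 * s * int L * int q ^ k \<noteq> 0" using s0 L q3 by simp
  ultimately obtain p where p: "prime p" "[int p = - x] (mod 4 * s * int L * int q ^ k)"
    using dirichlet_int[of "4 * s * int L * int q ^ k" "- x"] by blast
  define v where "v = - int p"
  have v: "[v = x] (mod 4 * s * int L * int q ^ k)"
    using p(2) cong_minus_minus_iff[of "int p" "- x"] by (simp add: v_def)
  have v1: "[v = 1] (mod 4 * s * int L)" using v x(1) by (meson cong_modulus_mult cong_trans)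
  have va: "[v = a] (mod int q ^ k)"
    using v x(2) by (metis cong_modulus_mult cong_trans mult.commute)
  have q_v: "\<not> int q dvd v"
  proof
    assume "int q dvd v"
    moreover have "[v = a] (mod int q)"
      using va by (rule cong_dvd_modulus) (use k in \<open>auto intro: dvd_power\<close>)
    ultimately show False using q_a by (simp add: cong_dvd_iff)
  qed
  \<comment> \<open>As \<open>p \<equiv> -1\<close> modulo \<open>4 L\<close>, half of \<open>p - 1\<close> is \<open>-1\<close> modulo \<open>L\<close>. Its square is a multiple of
    \<open>(p - 1)/2\<close> that is \<open>1\<close> modulo \<open>L\<close>.\<close>
  obtain f where f: "v = 1 + 4 * s * int L * f" using v1 by (metis cong_iff_lin cong_sym)
  define h where "h = (p - 1) div 2"
  have p_f: "int p = 2 * (- 2 * s * int L * f) - 1" using f by (simp add: v_def)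
  then have h: "p = 2 * h + 1" and "int h = (- 2 * s * f) * int L - 1"
  proof -
    have "odd (int p)" unfolding p_f by presburger
    then have "odd p" by simp
    then show "p = 2 * h + 1" unfolding h_def by (auto elim: oddE)
    then show "int h = (- 2 * s * f) * int L - 1" using p_f by (simp add: mult_ac)
  qed
  then have hL: "[int (h ^ 2) = 1] (mod int L)"
    by (simp add: cong_iff_dvd_diff power2_eq_square left_diff_distrib right_diff_distrib flip: mult.assoc)
  then have "[h ^ 2 = 1] (mod L)" by (simp flip: cong_int_iff)
  have qm_a: "[int q ^ (h ^ 2) = int q] (mod a)"
  proof -
    have "h \<noteq> 0"
    proof
      assume "h = 0"
      then have "p = 1" using h by simp
      then show False using p(1) by simp
    qed
    then have "h ^ 2 \<ge> 1" by (simp add: Suc_le_eq)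
    moreover from this have "L dvd h ^ 2 - 1"
      using \<open>[h ^ 2 = 1] (mod L)\<close> by (simp add: cong_altdef_nat)
    ultimately obtain i where i: "h ^ 2 = Suc (L * i)" by (metis dvdE le_add_diff_inverse plus_1_eq_Suc)
    have "coprime (int q) a" using prime_imp_coprime[OF pq q_a] .
    from euler_theorem_int[OF False this] have "[int q ^ L = 1] (mod a)" by (simp add: L_def)
    then have "[int q * (int q ^ L) ^ i = int q * 1 ^ i] (mod a)" by (intro cong_mult cong_pow cong_refl)
    then show ?thesis by (simp add: i power_mult)
  qed
  have qm_v: "[int q ^ (h ^ 2) = 1] (mod v) \<or> [int q ^ (h ^ 2) = - 1] (mod v)"
  proof -
    have pp: "prime (int p)" using p(1) by simp
    have "\<not> int p dvd int q"
    proof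
      assume "int p dvd int q"
      then have "p = q" using p(1) q(1) primes_dvd_imp_eq by auto
      then show False using q_v by (simp add: v_def)
    qed
    then have "coprime (int q) (int p)" using prime_imp_coprime[OF pp] coprime_commute by blast
    from euler_theorem_int[OF _ this] have "[int q ^ (p - 1) = 1] (mod int p)"
      using p(1) by (auto simp: totient_prime)
    then have "int p dvd (int q ^ h) ^ 2 - 1"
      by (simp add: h cong_iff_dvd_diff power_mult mult.commute flip: power_mult)
    then have "int p dvd (int q ^ h - 1) * (int q ^ h + 1)"
      by (simp add: power2_eq_square algebra_simps)
    then have "[int q ^ h = 1] (mod int p) \<or> [int q ^ h = - 1] (mod int p)"
      using pp by (simp add: prime_dvd_mult_iff cong_iff_dvd_diff)
    then have "[(int q ^ h) ^ h = 1 ^ h] (mod int p) \<or> [(int q ^ h) ^ h = (- 1) ^ h] (mod int p)"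
      by (metis cong_pow)
    then show ?thesis
      by (cases "even h") (auto simp: v_def power2_eq_square power_mult)
  qed
  obtain j where j: "[u ^ j * v = a] (mod int q ^ (k + h ^ 2))"
    using power_multiple_lift[OF q(1) odd_q k wk w(2) q_u q_v va] by blast
  have "[u ^ j * v = a] (mod s * int q ^ (h ^ 2))"
  proof (rule coprime_cong_mult)
    have "[v = 1] (mod s)" using v1 by (metis cong_modulus_mult mult.assoc mult.commute)
    then have "[u ^ j * v = 1 ^ j * 1] (mod s)" by (intro cong_mult cong_pow cong_u)
    then show "[u ^ j * v = a] (mod s)" using a1 by (simp add: cong_def)
    show "[u ^ j * v = a] (mod int q ^ h\<^sup>2)"
      using j by (rule cong_dvd_modulus) (simp add: le_imp_power_dvd)
    show "coprime s (int q ^ h\<^sup>2)" using prime_imp_coprime[OF pq q_s] by (metis coprime_commute coprime_power_right_iff)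
  qed
  note col = this
  \<comment> \<open>The chain of columns, read backwards from one whose second entry is a unit.\<close>
  obtain g :: int where g: "g = 1 \<or> g = - 1" "[int q ^ h\<^sup>2 = g] (mod v)" using qm_v by blast
  obtain r where r: "v = 1 + s * r" using f by (metis mult.assoc mult.left_commute)
  have "reducible (1 + of_int s * of_int r) (of_int (u ^ j * g))"
  proof (rule reducible_unit)
    have "1 / of_int (u ^ j * g) = (of_int g / of_int u ^ j :: real)" using g(1) by auto
    then show "1 / of_int (u ^ j * g) \<in> R" using of_int_divide_u_in_R[of g j] by simp
    show "of_int (u ^ j * g) \<in> R" by (rule of_int_in_Z_inv)
    show "of_int (u ^ j * g) \<noteq> (0 :: real)" using g(1) by auto
  qed simp_all
  then have "reducible (of_int v) (of_int (u ^ j * g))" by (simp add: r)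
  then have "reducible (of_int v) (of_int (u ^ j * int q ^ h\<^sup>2))"
    by (rule reducible_cong_right) (intro cong_mult cong_refl g(2))
  from reducible_scale[OF this, of j]
  have "reducible (of_int (u ^ j * v)) (of_int (int q ^ h\<^sup>2))" by simp
  then have "reducible (of_int a) (of_int (int q ^ h\<^sup>2))"
    by (rule reducible_cong_left) (use col in \<open>rule cong_sym\<close>)
  then have "reducible (of_int a) (of_int (int q))"
    by (rule reducible_cong_right) (use qm_a in \<open>rule cong_sym\<close>)
  then show ?thesis
    by (rule reducible_cong_right) (use q(3) in \<open>rule cong_sym\<close>)
qed

section \<open>General columns\<close>

text \<open>By the pigeonhole principle two powers of \<open>u\<close> agree modulo \<open>c\<close>. The factor \<open>u ^ i\<close> absorbs the common
  divisors of \<open>c\<close> and \<open>u\<close> and is invertible in \<open>R\<close>.\<close>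

lemma power_u_cong_1:
  fixes c :: int
  assumes "c \<noteq> 0"
  obtains N i z where "N > 0" "u ^ i * (u ^ N - 1) = c * z"
proof -
  have "\<not> inj_on (\<lambda>i. u ^ i mod c) (UNIV :: nat set)"
  proof
    assume inj: "inj_on (\<lambda>i. u ^ i mod c) (UNIV :: nat set)"
    have "u ^ i mod c \<in> {- \<bar>c\<bar>..\<bar>c\<bar>}" for i
      using abs_mod_less[OF assms, of "u ^ i"] by auto
    then have "range (\<lambda>i. u ^ i mod c) \<subseteq> {- \<bar>c\<bar>..\<bar>c\<bar>}" by blast
    then have "finite (range (\<lambda>i. u ^ i mod c))" by (rule finite_subset) simp
    then show False using inj by (simp add: finite_image_iff)
  qed
  then obtain i j where ij: "u ^ i mod c = u ^ j mod c" "i < j"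
    unfolding inj_on_def by (metis linorder_neqE_nat UNIV_I)
  have "c dvd u ^ j - u ^ i" using ij(1) by (metis mod_eq_dvd_iff)
  moreover have "u ^ j = u ^ i * u ^ (j - i)" using ij(2) by (simp flip: power_add)
  ultimately have "c dvd u ^ i * (u ^ (j - i) - 1)" by (simp add: right_diff_distrib)
  then show ?thesis using that[of "j - i" i] ij(2) by auto
qed

text \<open>The replacement \<open>a' = 1 + u ^ M (a - 1)\<close> achieves three things for suitable \<open>M\<close>: it is an integer since \<open>u ^ M\<close>
  clears the denominator of \<open>a - 1\<close>; it is congruent to \<open>a\<close> modulo \<open>s c R\<close> since \<open>u ^ M \<equiv> 1\<close> modulo \<open>c R\<close>; and it
  is \<open>1\<close> modulo \<open>t\<close>, so unimodularity over \<open>R\<close> yields coprimality to \<open>c\<close> over the integers.\<close>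

lemma reducible_unimodular_int:
  fixes c :: int
  assumes c: "c \<noteq> 0" and r: "r \<in> R" "a = 1 + of_int s * r"
    and x: "x \<in> R" and y: "y \<in> R" and xy: "a * x + of_int c * y = 1"
  shows "reducible a (of_int c)"
proof -
  obtain N i z where N: "N > 0" "u ^ i * (u ^ N - 1) = c * z" using power_u_cong_1[OF c] .
  obtain b n where b: "r * of_int t ^ n = of_int b" using Z_inv_clear_denominator[OF t0 r(1)] .
  define M where "M = N * Suc n"
  obtain g where "(u ^ N) ^ Suc n - 1 = (u ^ N - 1) * g"
    using power_diff_1_eq[of "u ^ N" "Suc n"] by blast
  then have g: "u ^ M - 1 = (u ^ N - 1) * g" by (simp only: M_def power_mult)
  define w where "w = of_int (z * g) / (of_int u ^ i :: real)"
  have w: "w \<in> R" unfolding w_def by (rule of_int_divide_u_in_R)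
  have "of_int (u ^ i * (u ^ M - 1)) = (of_int (c * z * g) :: real)" unfolding g by (simp flip: N(2))
  then have uM: "of_int u ^ M - 1 = of_int c * w" by (simp add: w_def field_simps)
  have "M \<ge> Suc n" using mult_le_mono1[of 1 N "Suc n"] N(1) by (simp add: M_def)
  then obtain l where l: "M = n + Suc l" by (metis add_Suc_right add.commute add_Suc le_iff_add)
  define b' where "b' = e ^ n * b * u ^ l * e"
  have rb: "r * of_int u ^ M = of_int (t * b')"
  proof -
    have "r * of_int u ^ M = (r * of_int t ^ n) * of_int (e ^ n * u ^ l * u)"
      by (simp add: l power_add u_def power_mult_distrib)
    then show ?thesis by (simp add: b b'_def u_def)
  qed
  define a' where "a' = 1 + s * (t * b')"
  have "of_int a' - a = (of_int u ^ M - 1) * (of_int s * r)"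
    unfolding a'_def r(2) by (simp flip: rb add: algebra_simps) (use rb in \<open>simp add: algebra_simps\<close>)
  then have a': "of_int a' = a + of_int c * (of_int s * (w * r))"
    unfolding uM by (simp add: algebra_simps)
  have wr: "w * r \<in> R" using w r(1) by (rule mult_in_Z_inv)
  define y' where "y' = y - of_int s * (w * r) * x"
  have y': "y' \<in> R" unfolding y'_def by (intro diff_in_Z_inv mult_in_Z_inv wr x y) auto
  have xy': "of_int a' * x + of_int c * y' = 1"
    using xy unfolding a' y'_def by (simp add: algebra_simps)
  obtain X j where X: "x * of_int t ^ j = of_int X" using Z_inv_clear_denominator[OF t0 x] .
  obtain Y k where Y: "y' * of_int t ^ k = of_int Y" using Z_inv_clear_denominator[OF t0 y'] .
  have "of_int (a' * (X * t ^ k) + c * (Y * t ^ j)) = (of_int (t ^ (j + k)) :: real)"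
  proof -
    have "of_int (a' * (X * t ^ k) + c * (Y * t ^ j))
        = (of_int a' * x + of_int c * y') * of_int t ^ (j + k)"
      by (simp add: power_add algebra_simps flip: X Y)
    then show ?thesis by (simp add: xy')
  qed
  then have XY: "a' * (X * t ^ k) + c * (Y * t ^ j) = t ^ (j + k)" by (simp only: of_int_eq_iff)
  have "coprime a' c"
  proof (rule coprimeI)
    fix d assume d: "d dvd a'" "d dvd c"
    then have "d dvd t ^ (j + k)" unfolding XY[symmetric] by simp
    moreover have "coprime d t"
    proof (rule coprimeI)
      fix f assume "f dvd d" "f dvd t"
      then have "f dvd a' - s * (t * b')" using d(1) by (meson dvd_diff dvd_mult dvd_mult2 dvd_trans)
      then show "is_unit f" by (simp add: a'_def)
    qed
    then have "coprime d (t ^ (j + k))" by simp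
    ultimately show "is_unit d" by (metis coprime_common_divisor dvd_refl)
  qed
  moreover have "[a' = 1] (mod s)" by (simp add: a'_def cong_iff_dvd_diff)
  ultimately have "reducible (of_int a') (of_int c)" by (intro reducible_coprime)
  from reducible_add_left[OF this uminus_in_Z_inv[OF wr]]
  show ?thesis by (simp add: a' algebra_simps)
qed

text \<open>Scaling by a power of \<open>u\<close> turns the second entry into an integer. If it is zero, the first entry is a
  unit of \<open>R\<close>.\<close>

lemma reducible_unimodular:
  assumes r: "r \<in> R" "a = 1 + of_int s * r" and c: "c \<in> R"
    and x: "x \<in> R" and y: "y \<in> R" and xy: "a * x + c * y = 1"
  shows "reducible a c"
proof (cases "c = 0")
  case True
  have "a \<in> R" unfolding r(2) by (intro add_in_Z_inv mult_in_Z_inv r(1)) auto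
  moreover have a0: "a \<noteq> 0" using xy True by auto
  moreover have "1 / a = x" using xy True a0 by (simp add: field_simps)
  ultimately have "reducible a a" using reducible_unit[of a r] r x by simp
  from reducible_add_right[OF this minus_one_in_Z_inv] show ?thesis by (simp add: True)
next
  case False
  obtain k n where k: "c = of_int k / of_int u ^ (2 * n)" using R_even_denominator[OF c] .
  define U where "U = (of_int u :: real) ^ (2 * n)"
  have U: "U \<noteq> 0" "U \<in> R" by (auto simp: U_def intro: power_in_Z_inv)
  have iU: "1 / U \<in> R" using of_int_divide_u_in_R[of 1 "2 * n"] by (simp add: U_def)
  have "[u ^ (2 * n) = 1 ^ (2 * n)] (mod s)" by (intro cong_pow cong_u)
  then obtain z where z: "u ^ (2 * n) = 1 + s * z" by (metis cong_iff_lin cong_sym power_one)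
  have Uz: "U = 1 + of_int s * of_int z" unfolding U_def by (simp flip: of_int_power add: z)
  have "reducible (a / U) (of_int k)"
  proof (rule reducible_unimodular_int)
    show "k \<noteq> 0" using False k by auto
    show "(r - of_int z) * (1 / U) \<in> R" by (intro mult_in_Z_inv diff_in_Z_inv r iU) auto
    show "a / U = 1 + of_int s * ((r - of_int z) * (1 / U))"
      using U(1) unfolding r(2) by (simp add: field_simps Uz)
    show "x * U \<in> R" "y * (1 / U) \<in> R" by (intro mult_in_Z_inv x y U iU)+
    show "a / U * (x * U) + of_int k * (y * (1 / U)) = 1"
      using xy U(1) unfolding k U_def[symmetric] by (simp add: field_simps)
  qed
  from reducible_scale[OF this, of "2 * n"] show ?thesis using U(1) by (simp add: k flip: U_def)
qed

section \<open>The two groups agree\<close>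

lemma Gamma_one_iff:
  "mat2 a b c d \<in> Gamma_one t s \<longleftrightarrow> a * d - b * c = 1 \<and> b \<in> R \<and>
     (\<exists>a'\<in>R. a = 1 + of_int s * a') \<and> (\<exists>c'\<in>R. c = of_int s * c') \<and> (\<exists>d'\<in>R. d = 1 + of_int s * d')"
proof -
  have "1 + of_int s * z \<in> R" "of_int s * z \<in> R" if "z \<in> R" for z
    using that by (auto intro!: add_in_Z_inv mult_in_Z_inv)
  then show ?thesis
    unfolding Gamma_one_def SL2_Z_inv_def
    by (auto simp: forall_2 image_iff algebra_simps)
qed

lemma Gamma_one_mult:
  assumes "A \<in> Gamma_one t s" "B \<in> Gamma_one t s"
  shows "A ** B \<in> Gamma_one t s"
proof -
  obtain a1 b1 c1 d1 where A: "A = mat2 a1 b1 c1 d1" using mat2_eta by blast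
  obtain a2 b2 c2 d2 where B: "B = mat2 a2 b2 c2 d2" using mat2_eta by blast
  from assms(1)[unfolded A Gamma_one_iff] obtain x1 y1 z1 where
    1: "a1 * d1 - b1 * c1 = 1" "b1 \<in> R" "x1 \<in> R" "y1 \<in> R" "z1 \<in> R"
       "a1 = 1 + of_int s * x1" "c1 = of_int s * y1" "d1 = 1 + of_int s * z1" by blast
  from assms(2)[unfolded B Gamma_one_iff] obtain x2 y2 z2 where
    2: "a2 * d2 - b2 * c2 = 1" "b2 \<in> R" "x2 \<in> R" "y2 \<in> R" "z2 \<in> R"
       "a2 = 1 + of_int s * x2" "c2 = of_int s * y2" "d2 = 1 + of_int s * z2" by blast
  have "det (A ** B) = 1" using 1(1) 2(1) unfolding det_mul by (simp add: A B)
  then have "(a1 * a2 + b1 * c2) * (c1 * b2 + d1 * d2) - (a1 * b2 + b1 * d2) * (c1 * a2 + d1 * c2) = 1"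
    by (simp only: A B mat2_mult det_mat2)
  moreover have "a1 * b2 + b1 * d2 \<in> R"
    unfolding 1 2 by (intro add_in_Z_inv mult_in_Z_inv 1 2) auto
  moreover have "a1 * a2 + b1 * c2 = 1 + of_int s * (x1 + x2 + of_int s * x1 * x2 + b1 * y2)"
    unfolding 1 2 by (simp add: algebra_simps)
  moreover have "x1 + x2 + of_int s * x1 * x2 + b1 * y2 \<in> R"
    by (intro add_in_Z_inv mult_in_Z_inv 1 2) auto
  moreover have "c1 * a2 + d1 * c2 = of_int s * (y1 * a2 + d1 * y2)"
    unfolding 1 2 by (simp add: algebra_simps)
  moreover have "y1 * a2 + d1 * y2 \<in> R"
    unfolding 1 2 by (intro add_in_Z_inv mult_in_Z_inv 1 2) auto
  moreover have "c1 * b2 + d1 * d2 = 1 + of_int s * (z1 + z2 + of_int s * z1 * z2 + y1 * b2)"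
    unfolding 1 2 by (simp add: algebra_simps)
  moreover have "z1 + z2 + of_int s * z1 * z2 + y1 * b2 \<in> R"
    by (intro add_in_Z_inv mult_in_Z_inv 1 2) auto
  ultimately show ?thesis
    unfolding A B mat2_mult Gamma_one_iff by blast
qed

lemma generators_in_Gamma_one:
  shows "mat2 1 (of_int k) 0 1 \<in> Gamma_one t s"
    and "mat2 1 0 (of_int s * of_int k / of_int t) 1 \<in> Gamma_one t s"
proof -
  have 1: "\<exists>z\<in>R. 1 = 1 + of_int s * z" "\<exists>z\<in>R. 0 = of_int s * z"
    by (rule bexI[of _ 0]; simp)+
  have "of_int k / of_int t \<in> R" using divide_power_in_Z_inv[of k t 1] by simp
  then have 2: "\<exists>z\<in>R. of_int s * of_int k / of_int t = of_int s * z"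
    by (intro bexI[of _ "of_int k / of_int t"]) simp
  show "mat2 1 0 (of_int s * of_int k / of_int t) 1 \<in> Gamma_one t s"
    unfolding Gamma_one_iff by (intro conjI 1 2) simp_all
  show "mat2 1 (of_int k) 0 1 \<in> Gamma_one t s"
    unfolding Gamma_one_iff by (intro conjI 1) simp_all
qed

lemma H_subset_Gamma_one: "H \<subseteq> Gamma_one t s"
proof
  fix A assume "A \<in> H"
  then show "A \<in> Gamma_one t s"
    unfolding Gamma_gen_def q_of_rat
  proof (induction rule: generate.induct)
    case one
    show ?case using generators_in_Gamma_one(1)[of 0] by (simp add: SL2R_def mat_1_eq_mat2)
  next
    case (incl h)
    then show ?case using generators_in_Gamma_one(1)[of 1] generators_in_Gamma_one(2)[of 1] by auto
  next
    case (inv h)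
    then show ?case
      using generators_in_Gamma_one(1)[of "- 1"] generators_in_Gamma_one(2)[of "- 1"]
      by (auto simp: inv_SL2R_mat2)
  next
    case (eng h1 h2)
    then show ?case using Gamma_one_mult[of h1 h2] by (simp add: SL2R_def)
  qed
qed

text \<open>An element of \<open>H\<close> with the same first column differs from the given matrix by an upper unipotent factor,
  whose entry lies in \<open>R\<close>.\<close>

theorem Gamma_one_subset_H: "Gamma_one t s \<subseteq> H"
proof
  fix A assume A: "A \<in> Gamma_one t s"
  obtain a b c d where A_def: "A = mat2 a b c d" using mat2_eta by blast
  from A[unfolded A_def Gamma_one_iff] obtain r c' d1 where
    1: "a * d - b * c = 1" "b \<in> R" "r \<in> R" "a = 1 + of_int s * r" "c' \<in> R" "c = of_int s * c'"
       "d1 \<in> R" "d = 1 + of_int s * d1" by blast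
  have d: "d \<in> R" unfolding 1 by (intro add_in_Z_inv mult_in_Z_inv 1) auto
  have "reducible a c'"
  proof (rule reducible_unimodular[OF 1(3,4,5) d])
    show "- (of_int s * b) \<in> R" by (intro uminus_in_Z_inv mult_in_Z_inv 1) auto
    show "a * d + c' * - (of_int s * b) = 1" using 1(1) unfolding 1(6) by (simp add: algebra_simps)
  qed
  then obtain b' d' where h: "mat2 a b' c d' \<in> H" by (auto simp: reducible_def 1(6))
  then have "mat2 a b' c d' \<in> Gamma_one t s" using H_subset_Gamma_one by blast
  then have 2: "a * d' - b' * c = 1" "b' \<in> R" "d' \<in> R"
    unfolding Gamma_one_iff by (auto intro!: add_in_Z_inv mult_in_Z_inv)
  define x where "x = d' * b - b' * d"
  have "x \<in> R" unfolding x_def by (intro diff_in_Z_inv mult_in_Z_inv 1 2 d) auto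
  from Gamma_gen_mult[OF h upper_in_H[OF this]]
  have "mat2 a (a * x + b') c (c * x + d') \<in> H" by simp
  moreover have "a * x + b' = b"
  proof -
    have "a * x + b' = b * (a * d' - b' * c) + b' * (1 - (a * d - b * c))"
      unfolding x_def by (simp add: algebra_simps)
    then show ?thesis by (simp add: 1(1) 2(1))
  qed
  moreover have "c * x + d' = d"
  proof -
    have "c * x + d' = d * (a * d' - b' * c) + d' * (1 - (a * d - b * c))"
      unfolding x_def by (simp add: algebra_simps)
    then show ?thesis by (simp add: 1(1) 2(1))
  qed
  ultimately show "A \<in> H" by (simp add: A_def)
qed

end

theorem corollary1p4:
  fixes s t :: int
  assumes "[t = 1] (mod s) \<or> [t = - 1] (mod s)"
    and "(t\<^sup>2 - 1) * s * t \<noteq> 0"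
  shows "(of_int s / of_int t :: rat) \<in> CS"
proof -
  obtain e where e: "e = 1 \<or> e = - 1" "[t = e] (mod s)" using assms(1) by blast
  then obtain m where m: "t = e + s * m" by (metis cong_iff_lin cong_sym)
  have nz: "s \<noteq> 0" "t \<noteq> 0" "t \<noteq> 1" "t \<noteq> - 1" using assms(2) by auto
  then have t2: "\<bar>t\<bar> \<ge> 2" by auto
  interpret unit_one_mod s t e m using e(1) m nz(1) t2 by (rule unit_one_mod.intro)
  have "m \<noteq> 0" using m e(1) nz(3,4) by auto
  then have "\<bar>s\<bar> * 1 \<le> \<bar>s\<bar> * \<bar>m\<bar>" by (intro mult_left_mono) auto
  also have "\<bar>s\<bar> * \<bar>m\<bar> = \<bar>s * m\<bar>" by (simp only: abs_mult)
  also have "s * m = t - e" using m by simp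
  finally have "\<bar>s\<bar> < 4 * \<bar>t\<bar>" using e(1) t2 by linarith
  then have "of_int \<bar>s\<bar> < (of_int (4 * \<bar>t\<bar>) :: rat)" by (simp only: of_int_less_iff)
  then have "\<bar>of_int s\<bar> < (4 * \<bar>of_int t\<bar> :: rat)" by simp
  then have "\<bar>of_int s / of_int t\<bar> < (4 :: rat)"
    using nz(2) by (simp add: abs_divide divide_less_eq)
  then have "- 4 < (of_int s / of_int t :: rat)" "of_int s / of_int t < (4 :: rat)" by linarith+
  then show ?thesis
    unfolding CS_iff[OF coprime_s_t nz(2) refl]
    using H_subset_Gamma_one Gamma_one_subset_H by blast
qed

end
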